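(* Let $S$ be the supervariety of $(4|2)\times2$ supermatrices whose upper $2\times2$ minor $a_{11}a_{22}-a_{12}a_{21}$ is invertible, with the right action of $\mathrm{GL}_2(\mathbb{C})$ by matrix multiplication, and let $\mathbb{M}=S/\mathrm{GL}_2(\mathbb{C})$ be the chiral Minkowski superspace. The natural projection $p:S\to S/\mathrm{GL}_2(\mathbb{C})$ is a trivial principal bundle on the chiral superspace; that is, $\mathbb{C}[S]$ is a trivial $\mathbb{C}[\mathrm{GL}_2]$-Hopf–Galois extension of $\mathbb{C}[\mathbb{M}]\cong\mathbb{C}[S]^{\mathrm{coinv}\,\mathbb{C}[\mathrm{GL}_2]}$.
   Context: $\mathbb{C}[S]=\mathbb{C}[a_{ij},\alpha_{kl}][T]/((a_{11}a_{22}-a_{12}a_{21})T-1)$, with even generators $a_{ij}$ ($1\le i\le4$, $j=1,2$) and odd generators $\alpha_{kl}$ ($k=5,6$, $l=1,2$). $\mathbb{C}[\mathrm{GL}_2]=\mathbb{C}[g_{ij}][T]/((g_{11}g_{22}-g_{12}g_{21})T-1)$, $i,j=1,2$, with its usual Hopf algebra structure. $\mathbb{C}[S]$ is a right $\mathbb{C}[\mathrm{GL}_2]$-comodule superalgebra via $\delta(a_{ij})=\sum_{m=1}^2a_{im}\otimes g_{mj}$, $\delta(\alpha_{kl})=\sum_{m=1}^2\alpha_{km}\otimes g_{ml}$. $\mathbb{C}[\mathbb{M}]=\mathbb{C}[u_{ij},\nu_{kl}]$ is the polynomial superalgebra with even generators $u_{ij}$ ($i=3,4$, $j=1,2$) and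 odd generators $\nu_{kl}$ ($k=5,6$, $l=1,2$). Let $H$ be a Hopf superalgebra, $A$ a right $H$-comodule superalgebra with coaction $\delta:A\to A\otimes H$, and $B=A^{\mathrm{coinv}\,H}=\{a\in A\mid\delta(a)=a\otimes1\}$. The extension $B\subset A$ is $H$-Hopf–Galois if the canonical map $\chi=(m_A\otimes\mathrm{id})(\mathrm{id}\otimes_B\delta):A\otimes_BA\to A\otimes H$ is bijective. The extension is a trivial (or cleft) extension if there is a right $H$-comodule map $j:H\to A$ (a cleaving map) that is convolution invertible, i.e. there is $h:H\to A$ inverse to $j$ for the convolution product $j\star h=m_A\circ(j\otimes h)\circ\Delta$, with unit $f\mapsto\varepsilon(f)\cdot 1$. A trivial Hopf–Galois extension is the algebraic counterpart of a trivial principal bundle in this affine setting. *)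

theory Defs
  imports Complex_Main "HOL-Library.Poly_Mapping" "HOL-Library.Numeral_Type" "HOL-Library.Z2"
begin

section \<open>Complex vector spaces and superalgebras\<close>

class complex_vector = ab_group_add +
  fixes scaleC :: "complex \<Rightarrow> 'a \<Rightarrow> 'a"  (infixr \<open>*\<^sub>C\<close> 75)
  assumes scaleC_add_right: "c *\<^sub>C (x + y) = c *\<^sub>C x + c *\<^sub>C y"
    and scaleC_add_left: "(c + d) *\<^sub>C x = c *\<^sub>C x + d *\<^sub>C x"
    and scaleC_scaleC [simp]: "c *\<^sub>C d *\<^sub>C x = (c * d) *\<^sub>C x"
    and scaleC_one [simp]: "1 *\<^sub>C x = x"

global_interpretation cvec: vector_space "scaleC :: complex \<Rightarrow> 'a \<Rightarrow> 'a::complex_vector"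
  by unfold_locales (simp_all add: scaleC_add_right scaleC_add_left)

abbreviation clinear :: "('a::complex_vector \<Rightarrow> 'b::complex_vector) \<Rightarrow> bool"
  where "clinear \<equiv> Vector_Spaces.linear scaleC scaleC"

lemma clinear_iff:
  "clinear f \<longleftrightarrow> (\<forall>x y. f (x + y) = f x + f y) \<and> (\<forall>c x. f (c *\<^sub>C x) = c *\<^sub>C f x)"
  for f :: "'a::complex_vector \<Rightarrow> 'b::complex_vector"
  unfolding Vector_Spaces.linear_def module_hom_def module_hom_axioms_def
  by (auto intro: cvec.module_axioms cvec.vector_space_axioms)

lemma clinearI:
  "(\<And>x y. f (x + y) = f x + f y) \<Longrightarrow> (\<And>c x. f (c *\<^sub>C x) = c *\<^sub>C f x) \<Longrightarrow> clinear f"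
  by (simp add: clinear_iff)

lemma clinear_add: "clinear f \<Longrightarrow> f (x + y) = f x + f y"
  and clinear_scale: "clinear f \<Longrightarrow> f (c *\<^sub>C x) = c *\<^sub>C f x"
  by (simp_all add: clinear_iff)

lemma clinear_zero: "clinear f \<Longrightarrow> f 0 = 0"
  using clinear_scale[of f 0 0] by simp

lemma clinear_diff: "clinear f \<Longrightarrow> f (x - y) = f x - f y"
  using clinear_add[of f "x - y" y] by (simp add: algebra_simps)

lemma clinear_neg: "clinear f \<Longrightarrow> f (- x) = - f x"
  using clinear_diff[of f 0 x] by (simp add: clinear_zero)

lemma clinear_span:
  assumes "clinear f" "\<And>x. x \<in> S \<Longrightarrow> f x \<in> cvec.span T" "x \<in> cvec.span S"
  shows "f x \<in> cvec.span T"
  using assms(3)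
proof (induction rule: cvec.span_induct_alt)
  case base show ?case using assms(1) by (simp add: clinear_zero cvec.span_zero)
next
  case (step c x y)
  then show ?case using assms(1,2)
    by (simp add: clinear_add clinear_scale cvec.span_add cvec.span_scale)
qed

text \<open>A superalgebra is an associative unital algebra with a \<open>\<int>/2\<close>-grading;
  \<open>spart i x\<close> is the homogeneous component of \<open>x\<close> of degree \<open>i\<close>
  (0 for even, 1 for odd).  Supercommutativity is not assumed.\<close>

class superalgebra = complex_vector + ring + monoid_mult +
  fixes spart :: "bit \<Rightarrow> 'a \<Rightarrow> 'a"
  assumes mult_scaleC_left [simp]: "(c *\<^sub>C x) * y = c *\<^sub>C (x * y)"
    and mult_scaleC_right [simp]: "x * (c *\<^sub>C y) = c *\<^sub>C (x * y)"
    and spart_add: "spart i (x + y) = spart i x + spart i y"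
    and spart_scaleC: "spart i (c *\<^sub>C x) = c *\<^sub>C spart i x"
    and spart_spart: "spart i (spart j x) = (if i = j then spart j x else 0)"
    and spart_decomp: "spart 0 x + spart 1 x = x"
    and spart_mult: "spart (i + j) (spart i x * spart j y) = spart i x * spart j y"

instantiation complex :: superalgebra
begin
definition scaleC_complex :: "complex \<Rightarrow> complex \<Rightarrow> complex"
  where [simp]: "scaleC_complex c x = c * x"
definition spart_complex :: "bit \<Rightarrow> complex \<Rightarrow> complex"
  where [simp]: "spart_complex i x = (if i = 0 then x else 0)"
instance by standard (auto simp: algebra_simps)
end

lemma spart_zero [simp]: "spart i (0 :: 'a::superalgebra) = 0"
  using spart_scaleC[of i 0 "0 :: 'a"] by simp

lemma spart_one: "spart 0 (1 :: 'a::superalgebra) = 1"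
proof -
  let ?e = "spart 0 (1 :: 'a)" and ?o = "spart 1 (1 :: 'a)"
  have s: "?e + ?o = 1" by (rule spart_decomp)
  have ee: "spart 0 (?e * ?e) = ?e * ?e" using spart_mult[of 0 0 1 1] by simp
  have eo: "spart 1 (?e * ?o) = ?e * ?o" using spart_mult[of 0 1 1 1] by simp
  have oo: "spart 0 (?o * ?o) = ?o * ?o" using spart_mult[of 1 1 1 1] by simp
  have ee1: "spart 1 (?e * ?e) = 0" by (subst ee[symmetric]) (simp add: spart_spart)
  have eo0: "spart 0 (?e * ?o) = 0" by (subst eo[symmetric]) (simp add: spart_spart)
  have 1: "?o = ?e * ?o + ?o * ?o" by (simp only: s mult_1_left flip: distrib_right)
  have "spart 0 ?o = spart 0 (?e * ?o + ?o * ?o)" by (rule arg_cong[OF 1])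
  then have o2: "?o * ?o = 0" by (simp add: spart_add eo0 oo spart_spart)
  have 2: "?e = ?e * ?e + ?e * ?o" by (simp only: s mult_1_right flip: distrib_left)
  have "spart 1 ?e = spart 1 (?e * ?e + ?e * ?o)" by (rule arg_cong[OF 2])
  then have "?e * ?o = 0" by (simp add: spart_add eo ee1 spart_spart)
  with 1 o2 have "?o = 0" by simp
  with s show ?thesis by simp
qed

text \<open>Morphisms of super vector spaces preserve the grading.\<close>

definition super_linear :: "('a::superalgebra \<Rightarrow> 'b::superalgebra) \<Rightarrow> bool"
  where "super_linear f \<longleftrightarrow> clinear f \<and> (\<forall>i x. f (spart i x) = spart i (f x))"

definition superalgebra_hom :: "('a::superalgebra \<Rightarrow> 'b::superalgebra) \<Rightarrow> bool"
  where "superalgebra_hom f \<longleftrightarrow>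
    super_linear f \<and> f 1 = 1 \<and> (\<forall>x y. f (x * y) = f x * f y)"

section \<open>Free vector spaces\<close>

instantiation poly_mapping :: (type, complex_vector) complex_vector
begin
definition scaleC_poly_mapping :: "complex \<Rightarrow> ('a \<Rightarrow>\<^sub>0 'b) \<Rightarrow> 'a \<Rightarrow>\<^sub>0 'b"
  where "scaleC_poly_mapping c p = Poly_Mapping.map (scaleC c) p"

lemma lookup_scaleC: "Poly_Mapping.lookup (c *\<^sub>C p) k = c *\<^sub>C Poly_Mapping.lookup p k"
  by (simp add: scaleC_poly_mapping_def Poly_Mapping.map.rep_eq when_def)

instance
  by standard
    (rule poly_mapping_eqI; simp add: lookup_scaleC lookup_add scaleC_add_right scaleC_add_left)+
end

text \<open>The linear extension of a map given on the standard basis.\<close>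

definition lin_ext :: "('x \<Rightarrow> 'b::complex_vector) \<Rightarrow> ('x \<Rightarrow>\<^sub>0 complex) \<Rightarrow> 'b"
  where "lin_ext f p = (\<Sum>x\<in>Poly_Mapping.keys p. Poly_Mapping.lookup p x *\<^sub>C f x)"

lemma lin_ext_superset:
  assumes "finite S" "Poly_Mapping.keys p \<subseteq> S"
  shows "lin_ext f p = (\<Sum>x\<in>S. Poly_Mapping.lookup p x *\<^sub>C f x)"
  unfolding lin_ext_def using assms
  by (intro sum.mono_neutral_left) (auto simp: in_keys_iff)

lemma clinear_lin_ext: "clinear (lin_ext f)"
proof (rule clinearI)
  fix p q :: "'a \<Rightarrow>\<^sub>0 complex" and c
  let ?S = "Poly_Mapping.keys p \<union> Poly_Mapping.keys q"
  have S: "finite ?S" by simp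
  show "lin_ext f (p + q) = lin_ext f p + lin_ext f q"
    using S Poly_Mapping.keys_add[of p q]
    by (simp add: lin_ext_superset[of ?S] lookup_add scaleC_add_left sum.distrib)
  have "Poly_Mapping.keys (c *\<^sub>C p) \<subseteq> Poly_Mapping.keys p"
    by (auto simp: in_keys_iff lookup_scaleC)
  then show "lin_ext f (c *\<^sub>C p) = c *\<^sub>C lin_ext f p"
    by (simp add: lin_ext_superset[of "Poly_Mapping.keys p"] lookup_scaleC cvec.scale_sum_right)
qed

lemma lin_ext_single [simp]: "lin_ext f (Poly_Mapping.single x c) = c *\<^sub>C f x"
  by (simp add: lin_ext_superset[of "{x}"])

lemma lin_ext_single_id: "lin_ext (\<lambda>x. Poly_Mapping.single x 1) p = p"
  by (rule poly_mapping_eqI) (auto simp: lin_ext_def lookup_sum lookup_scaleC lookup_single when_def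
      sum.delta in_keys_iff if_distrib cong: if_cong)

section \<open>Superalgebras given by generators and relations\<close>

datatype 'g word = Word (letters: "'g list")

instantiation word :: (type) monoid_add
begin
definition "0 = Word []"
definition "v + w = Word (letters v @ letters w)"
instance by standard (auto simp: zero_word_def plus_word_def)
end

text \<open>The free associative algebra on \<open>'g\<close>: formal combinations of words, multiplied by
  concatenation (\<open>Poly_Mapping\<close> provides the convolution product over the monoid of words).\<close>

type_synonym 'g free_alg = "'g word \<Rightarrow>\<^sub>0 complex"

definition fgen :: "'g \<Rightarrow> 'g free_alg"
  where "fgen x = Poly_Mapping.single (Word [x]) 1"

text \<open>A set of generators with parities, together with further homogeneous relations
  (elements to be set to zero) besides supercommutativity.\<close>

class presentation =
  fixes gpar :: "'a \<Rightarrow> bit"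
    and grel :: "'a free_alg set"
  assumes grel_homogeneous:
    "r \<in> grel \<Longrightarrow> \<exists>i. \<forall>w\<in>Poly_Mapping.keys r. sum_list (map gpar (letters w)) = i"

definition wpar :: "'g::presentation word \<Rightarrow> bit"
  where "wpar w = sum_list (map gpar (letters w))"

lemma wpar_zero [simp]: "wpar 0 = 0" and wpar_plus [simp]: "wpar (v + w) = wpar v + wpar w"
  by (simp_all add: wpar_def zero_word_def plus_word_def)

lift_definition fpart :: "bit \<Rightarrow> 'g::presentation free_alg \<Rightarrow> 'g free_alg"
  is "\<lambda>i p w. if wpar w = i then p w else 0"
  by (rule finite_subset) auto

definition koszul :: "bit \<Rightarrow> bit \<Rightarrow> complex"
  where "koszul i j = (if i = 1 \<and> j = 1 then - 1 else 1)"

definition super_relations :: "'g::presentation free_alg set"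
  where "super_relations =
    {fgen x * fgen y - koszul (gpar x) (gpar y) *\<^sub>C (fgen y * fgen x) | x y. True} \<union> grel"

definition relation_ideal :: "'g::presentation free_alg set"
  where "relation_ideal = cvec.span {a * r * b | a r b. r \<in> super_relations}"

lemma scaleC_eq_single: "c *\<^sub>C p = Poly_Mapping.single 0 c * p" for p :: "'g free_alg"
proof -
  have "scaleC c = (\<lambda>x. c * x)" by (auto simp: fun_eq_iff)
  then show ?thesis
    by (simp add: scaleC_poly_mapping_def mult_map_scale_conv_mult)
qed

lemma free_scale_left: "(c *\<^sub>C p) * q = c *\<^sub>C (p * q)" for p q :: "'g free_alg"
  by (simp add: scaleC_eq_single mult.assoc)

lemma single_zero_central: "p * Poly_Mapping.single 0 c = Poly_Mapping.single 0 c * p"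
  for p :: "'g free_alg"
proof -
  let ?f = "\<lambda>p::'g free_alg. p * Poly_Mapping.single 0 c" and ?g = "\<lambda>p::'g free_alg. Poly_Mapping.single 0 c * p"
  have lf: "clinear ?f" by (rule clinearI) (simp_all add: algebra_simps free_scale_left)
  have lg: "clinear ?g"
    by (rule clinearI) (simp_all add: algebra_simps scaleC_eq_single mult_single flip: mult.assoc)
  have P: "?f (lin_ext (\<lambda>x. Poly_Mapping.single x 1) p) = ?g (lin_ext (\<lambda>x. Poly_Mapping.single x 1) p)"
    unfolding lin_ext_def sum_distrib_left sum_distrib_right
    by (rule sum.cong) (simp_all add: scaleC_eq_single mult_single mult.commute)
  then show ?thesis by (simp add: lin_ext_single_id)
qed

lemma free_scale_right: "p * (c *\<^sub>C q) = c *\<^sub>C (p * q)" for p q :: "'g free_alg"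
  by (simp add: scaleC_eq_single single_zero_central flip: mult.assoc)

lemma ideal_mult_left: assumes "p \<in> relation_ideal" shows "q * p \<in> relation_ideal"
proof -
  have "clinear (\<lambda>p. q * p)"
    by (rule clinearI) (simp_all add: algebra_simps free_scale_right)
  moreover have "q * x \<in> cvec.span {a * r * b | a r b. r \<in> super_relations}"
    if "x \<in> {a * r * b | a r b. r \<in> super_relations}" for x
    using that by (auto intro!: cvec.span_base) (metis mult.assoc)
  ultimately show ?thesis
    using assms clinear_span unfolding relation_ideal_def by blast
qed

lemma ideal_mult_right: assumes "p \<in> relation_ideal" shows "p * q \<in> relation_ideal"
proof -
  have "clinear (\<lambda>p. p * q)"
    by (rule clinearI) (simp_all add: algebra_simps free_scale_left)
  moreover have "x * q \<in> cvec.span {a * r * b | a r b. r \<in> super_relations}"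
    if "x \<in> {a * r * b | a r b. r \<in> super_relations}" for x
    using that by (auto intro!: cvec.span_base) (metis mult.assoc)
  ultimately show ?thesis
    using assms clinear_span unfolding relation_ideal_def by blast
qed

lemma ideal_zero: "0 \<in> relation_ideal"
  and ideal_add: "p \<in> relation_ideal \<Longrightarrow> q \<in> relation_ideal \<Longrightarrow> p + q \<in> relation_ideal"
  and ideal_diff: "p \<in> relation_ideal \<Longrightarrow> q \<in> relation_ideal \<Longrightarrow> p - q \<in> relation_ideal"
  and ideal_neg: "p \<in> relation_ideal \<Longrightarrow> - p \<in> relation_ideal"
  and ideal_scale: "p \<in> relation_ideal \<Longrightarrow> c *\<^sub>C p \<in> relation_ideal"
  unfolding relation_ideal_def
  by (simp_all add: cvec.span_zero cvec.span_add cvec.span_diff cvec.span_neg cvec.span_scale)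

lemma clinear_fpart: "clinear (fpart i)"
  by (rule clinearI; rule poly_mapping_eqI)
     (simp_all add: fpart.rep_eq lookup_add lookup_scaleC)

definition fhom :: "bit \<Rightarrow> 'g::presentation free_alg \<Rightarrow> bool"
  where "fhom i p \<longleftrightarrow> (\<forall>w\<in>Poly_Mapping.keys p. wpar w = i)"

lemma fhom_fpart: "fhom i (fpart i p)"
  by (auto simp: fhom_def in_keys_iff fpart.rep_eq split: if_splits)

lemma fhom_mult: "fhom i p \<Longrightarrow> fhom j q \<Longrightarrow> fhom (i + j) (p * q)"
  using keys_mult[of p q] by (fastforce simp: fhom_def)

lemma fpart_fhom: "fhom j p \<Longrightarrow> fpart i p = (if i = j then p else 0)"
  by (rule poly_mapping_eqI) (auto simp: fhom_def fpart.rep_eq in_keys_iff)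

lemma fpart_decomp: "fpart 0 p + fpart 1 p = p"
  by (rule poly_mapping_eqI) (auto simp: fpart.rep_eq lookup_add)

lemma super_relations_hom:
  assumes "r \<in> super_relations" shows "\<exists>i. fhom i r"
proof -
  have gen: "fhom (gpar x) (fgen x)" for x :: 'a
    by (simp add: fhom_def fgen_def wpar_def)
  { fix x y :: 'a and c :: complex
    have "fhom (gpar x + gpar y) (fgen x * fgen y)" "fhom (gpar x + gpar y) (fgen y * fgen x)"
      using fhom_mult[OF gen[of x] gen[of y]] fhom_mult[OF gen[of y] gen[of x]]
      by (simp_all only: add.commute)
    then have "fhom (gpar x + gpar y) (fgen x * fgen y - c *\<^sub>C (fgen y * fgen x))"
      by (fastforce simp: fhom_def in_keys_iff lookup_minus lookup_scaleC) }
  then show ?thesis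
    using assms grel_homogeneous[of r] by (auto simp: super_relations_def fhom_def wpar_def)
qed

lemma ideal_fpart: "p \<in> relation_ideal \<Longrightarrow> fpart i p \<in> relation_ideal"
proof -
  assume p: "p \<in> relation_ideal"
  have "fpart i (a * r * b) \<in> relation_ideal" if r: "r \<in> super_relations" for a r b :: "'a free_alg"
  proof -
    obtain k where k: "fhom k r" using super_relations_hom[OF r] by blast
    have *: "fpart i (fpart j a * r * fpart l b) \<in> relation_ideal" for j l
    proof -
      have "fpart i (fpart j a * r * fpart l b) =
          (if i = j + k + l then fpart j a * r * fpart l b else 0)"
        by (rule fpart_fhom) (intro fhom_mult fhom_fpart k)
      then show ?thesis using r
        by (auto simp: ideal_zero) (auto simp: relation_ideal_def intro!: cvec.span_base)
    qed
    have "a * r * b = (fpart 0 a + fpart 1 a) * r * (fpart 0 b + fpart 1 b)"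
      by (simp only: fpart_decomp)
    also have "\<dots> = fpart 0 a * r * fpart 0 b + fpart 0 a * r * fpart 1 b
        + fpart 1 a * r * fpart 0 b + fpart 1 a * r * fpart 1 b"
      by (simp add: algebra_simps)
    finally show ?thesis using *
      by (simp add: clinear_add[OF clinear_fpart] ideal_add)
  qed
  then show ?thesis
    using p clinear_span[OF clinear_fpart, of "{a * r * b | a r b. r \<in> super_relations}" i
        "{a * r * b | a r b. r \<in> super_relations}" p]
    unfolding relation_ideal_def by auto
qed

quotient_type (overloaded) 'g pres_alg =
  "'g::presentation free_alg" / "\<lambda>p q. p - q \<in> relation_ideal"
proof (rule equivpI)
  show "reflp (\<lambda>p q::'g free_alg. p - q \<in> relation_ideal)" by (simp add: reflp_def ideal_zero)
  show "symp (\<lambda>p q::'g free_alg. p - q \<in> relation_ideal)"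
    by (rule sympI) (use ideal_neg in fastforce)
  show "transp (\<lambda>p q::'g free_alg. p - q \<in> relation_ideal)"
    by (rule transpI) (use ideal_add in fastforce)
qed

instantiation pres_alg :: (presentation) superalgebra
begin
lift_definition zero_pres_alg :: "'a pres_alg" is 0 .
lift_definition one_pres_alg :: "'a pres_alg" is 1 .
lift_definition plus_pres_alg :: "'a pres_alg \<Rightarrow> 'a pres_alg \<Rightarrow> 'a pres_alg" is "(+)"
  by (simp add: add_diff_add ideal_add)
lift_definition minus_pres_alg :: "'a pres_alg \<Rightarrow> 'a pres_alg \<Rightarrow> 'a pres_alg" is "(-)"
proof -
  fix p q r s :: "'a free_alg" assume "p - q \<in> relation_ideal" "r - s \<in> relation_ideal"
  then show "p - r - (q - s) \<in> relation_ideal"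
    using ideal_diff[of "p - q" "r - s"] by (simp add: algebra_simps)
qed
lift_definition uminus_pres_alg :: "'a pres_alg \<Rightarrow> 'a pres_alg" is "uminus"
  using ideal_neg by fastforce
lift_definition times_pres_alg :: "'a pres_alg \<Rightarrow> 'a pres_alg \<Rightarrow> 'a pres_alg" is "(*)"
proof -
  fix p q r s :: "'a free_alg" assume "p - q \<in> relation_ideal" "r - s \<in> relation_ideal"
  then have "(p - q) * r + q * (r - s) \<in> relation_ideal"
    by (intro ideal_add ideal_mult_left ideal_mult_right)
  then show "p * r - q * s \<in> relation_ideal" by (simp add: algebra_simps)
qed
lift_definition scaleC_pres_alg :: "complex \<Rightarrow> 'a pres_alg \<Rightarrow> 'a pres_alg" is scaleC
  by (metis ideal_scale cvec.scale_right_diff_distrib)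
lift_definition spart_pres_alg :: "bit \<Rightarrow> 'a pres_alg \<Rightarrow> 'a pres_alg" is fpart
  by (metis ideal_fpart clinear_diff clinear_fpart)
instance
proof
  fix x y z :: "'a pres_alg" and c d :: complex and i j :: bit
  show "x + y + z = x + (y + z)" by transfer (simp add: algebra_simps ideal_zero)
  show "x + y = y + x" by transfer (simp add: algebra_simps ideal_zero)
  show "0 + x = x" by transfer (simp add: ideal_zero)
  show "- x + x = 0" by transfer (simp add: ideal_zero)
  show "x - y = x + - y" by transfer (simp add: ideal_zero)
  show "c *\<^sub>C (x + y) = c *\<^sub>C x + c *\<^sub>C y" by transfer (simp add: scaleC_add_right ideal_zero)
  show "(c + d) *\<^sub>C x = c *\<^sub>C x + d *\<^sub>C x" by transfer (simp add: scaleC_add_left ideal_zero)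
  show "c *\<^sub>C d *\<^sub>C x = (c * d) *\<^sub>C x" by transfer (simp add: ideal_zero)
  show "1 *\<^sub>C x = x" by transfer (simp add: ideal_zero)
  show "x * y * z = x * (y * z)" by transfer (simp add: mult.assoc ideal_zero)
  show "1 * x = x" by transfer (simp add: ideal_zero)
  show "x * 1 = x" by transfer (simp add: ideal_zero)
  show "(x + y) * z = x * z + y * z" by transfer (simp add: algebra_simps ideal_zero)
  show "x * (y + z) = x * y + x * z" by transfer (simp add: algebra_simps ideal_zero)
  show "(c *\<^sub>C x) * y = c *\<^sub>C (x * y)" by transfer (simp add: free_scale_left ideal_zero)
  show "x * (c *\<^sub>C y) = c *\<^sub>C (x * y)" by transfer (simp add: free_scale_right ideal_zero)
  show "spart i (x + y) = spart i x + spart i y"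
    by transfer (simp add: clinear_add[OF clinear_fpart] ideal_zero)
  show "spart i (c *\<^sub>C x) = c *\<^sub>C spart i x"
    by transfer (simp add: clinear_scale[OF clinear_fpart] ideal_zero)
  show "spart i (spart j x) = (if i = j then spart j x else 0)"
    by (transfer fixing: i j) (simp add: fpart_fhom[OF fhom_fpart] ideal_zero)
  show "spart 0 x + spart 1 x = x"
    by transfer (simp add: fpart_decomp ideal_zero)
  show "spart (i + j) (spart i x * spart j y) = spart i x * spart j y"
    by transfer (simp add: fpart_fhom[OF fhom_mult[OF fhom_fpart fhom_fpart]] ideal_zero)
qed
end

section \<open>Tensor products over the complex numbers\<close>

definition tensor_relations :: "('a::complex_vector \<times> 'b::complex_vector \<Rightarrow>\<^sub>0 complex) set"
  where "tensor_relations =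
      {Poly_Mapping.single (a + a', b) 1 - Poly_Mapping.single (a, b) 1
         - Poly_Mapping.single (a', b) 1 | a a' b. True}
    \<union> {Poly_Mapping.single (a, b + b') 1 - Poly_Mapping.single (a, b) 1
         - Poly_Mapping.single (a, b') 1 | a b b'. True}
    \<union> {Poly_Mapping.single (c *\<^sub>C a, b) 1 - Poly_Mapping.single (a, b) c | a b c. True}
    \<union> {Poly_Mapping.single (a, c *\<^sub>C b) 1 - Poly_Mapping.single (a, b) c | a b c. True}"

quotient_type (overloaded) ('a, 'b) tensor =
  "'a::complex_vector \<times> 'b::complex_vector \<Rightarrow>\<^sub>0 complex" /
  "\<lambda>p q. p - q \<in> cvec.span tensor_relations"
proof (rule equivpI)
  let ?r = "\<lambda>p q :: 'a \<times> 'b \<Rightarrow>\<^sub>0 complex. p - q \<in> cvec.span tensor_relations"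
  show "reflp ?r" by (simp add: reflp_def cvec.span_zero)
  show "symp ?r" by (rule sympI) (use cvec.span_neg in fastforce)
  show "transp ?r" by (rule transpI) (use cvec.span_add in fastforce)
qed

instantiation tensor :: (complex_vector, complex_vector) complex_vector
begin
lift_definition zero_tensor :: "('a, 'b) tensor" is 0 .
lift_definition plus_tensor :: "('a, 'b) tensor \<Rightarrow> ('a, 'b) tensor \<Rightarrow> ('a, 'b) tensor" is "(+)"
  by (simp add: add_diff_add cvec.span_add)
lift_definition minus_tensor :: "('a, 'b) tensor \<Rightarrow> ('a, 'b) tensor \<Rightarrow> ('a, 'b) tensor" is "(-)"
proof -
  fix p q r s :: "'a \<times> 'b \<Rightarrow>\<^sub>0 complex"
  assume "p - q \<in> cvec.span tensor_relations" "r - s \<in> cvec.span tensor_relations"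
  then show "p - r - (q - s) \<in> cvec.span tensor_relations"
    using cvec.span_diff[of "p - q" _ "r - s"] by (simp add: algebra_simps)
qed
lift_definition uminus_tensor :: "('a, 'b) tensor \<Rightarrow> ('a, 'b) tensor" is "uminus"
  using cvec.span_neg by fastforce
lift_definition scaleC_tensor :: "complex \<Rightarrow> ('a, 'b) tensor \<Rightarrow> ('a, 'b) tensor" is scaleC
  by (metis cvec.span_scale cvec.scale_right_diff_distrib)
instance
proof
  fix x y z :: "('a, 'b) tensor" and c d :: complex
  show "x + y + z = x + (y + z)" by transfer (simp add: algebra_simps cvec.span_zero)
  show "x + y = y + x" by transfer (simp add: algebra_simps cvec.span_zero)
  show "0 + x = x" by transfer (simp add: cvec.span_zero)
  show "- x + x = 0" by transfer (simp add: cvec.span_zero)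
  show "x - y = x + - y" by transfer (simp add: cvec.span_zero)
  show "c *\<^sub>C (x + y) = c *\<^sub>C x + c *\<^sub>C y" by transfer (simp add: scaleC_add_right cvec.span_zero)
  show "(c + d) *\<^sub>C x = c *\<^sub>C x + d *\<^sub>C x" by transfer (simp add: scaleC_add_left cvec.span_zero)
  show "c *\<^sub>C d *\<^sub>C x = (c * d) *\<^sub>C x" by transfer (simp add: cvec.span_zero)
  show "1 *\<^sub>C x = x" by transfer (simp add: cvec.span_zero)
qed
end

lift_definition tens :: "'a::complex_vector \<Rightarrow> 'b::complex_vector \<Rightarrow> ('a, 'b) tensor"
    (infixr \<open>\<otimes>\<close> 76)
  is "\<lambda>a b. Poly_Mapping.single (a, b) 1" .

lemma scale_single: "c *\<^sub>C Poly_Mapping.single x d = Poly_Mapping.single x (c * d)"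
  for d :: complex
  by (rule poly_mapping_eqI) (simp add: lookup_scaleC lookup_single when_def)

lemma tens_add_left: "(a + a') \<otimes> b = a \<otimes> b + a' \<otimes> b"
  by transfer (rule cvec.span_base, simp only: tensor_relations_def diff_diff_eq[symmetric], blast)

lemma tens_add_right: "a \<otimes> (b + b') = a \<otimes> b + a \<otimes> b'"
  by transfer (rule cvec.span_base, simp only: tensor_relations_def diff_diff_eq[symmetric], blast)

lemma tens_scale_left: "(c *\<^sub>C a) \<otimes> b = c *\<^sub>C (a \<otimes> b)"
  by transfer (rule cvec.span_base, simp only: tensor_relations_def scale_single mult_1_right, blast)

lemma tens_scale_right: "a \<otimes> (c *\<^sub>C b) = c *\<^sub>C (a \<otimes> b)"
  by transfer (rule cvec.span_base, simp only: tensor_relations_def scale_single mult_1_right, blast)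

lemma tens_zero [simp]: "0 \<otimes> b = 0" "a \<otimes> 0 = 0"
  using tens_scale_left[of 0 0 b] tens_scale_right[of a 0 0] by simp_all

lemmas tens_simps = tens_add_left tens_add_right tens_scale_left tens_scale_right

definition cbilinear :: "('a::complex_vector \<Rightarrow> 'b::complex_vector \<Rightarrow> 'c::complex_vector) \<Rightarrow> bool"
  where "cbilinear \<phi> \<longleftrightarrow> (\<forall>b. clinear (\<lambda>a. \<phi> a b)) \<and> (\<forall>a. clinear (\<phi> a))"

lemma cbilinearI:
  assumes "\<And>a a' b. \<phi> (a + a') b = \<phi> a b + \<phi> a' b" "\<And>c a b. \<phi> (c *\<^sub>C a) b = c *\<^sub>C \<phi> a b"
    "\<And>a b b'. \<phi> a (b + b') = \<phi> a b + \<phi> a b'" "\<And>c a b. \<phi> a (c *\<^sub>C b) = c *\<^sub>C \<phi> a b"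
  shows "cbilinear \<phi>"
  using assms by (simp add: cbilinear_def clinear_iff)

text \<open>The linear map on the tensor product induced by a bilinear map
  (independent of the representative by bilinearity).\<close>

definition tlift :: "('a::complex_vector \<Rightarrow> 'b::complex_vector \<Rightarrow> 'c::complex_vector) \<Rightarrow>
    ('a, 'b) tensor \<Rightarrow> 'c"
  where "tlift \<phi> x = lin_ext (\<lambda>(a, b). \<phi> a b) (rep_tensor x)"

lemma tlift_abs:
  assumes "cbilinear \<phi>"
  shows "tlift \<phi> (abs_tensor p) = lin_ext (\<lambda>(a, b). \<phi> a b) p"
proof -
  let ?f = "lin_ext (\<lambda>(a, b). \<phi> a b)"
  have *: "?f r = 0" if "r \<in> tensor_relations" for r
    using that assms unfolding tensor_relations_def cbilinear_def
    by (auto simp: clinear_diff[OF clinear_lin_ext]) (auto simp: clinear_iff)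
  have "rep_tensor (abs_tensor p) - p \<in> cvec.span tensor_relations"
    using Quotient3_rep_abs[OF Quotient3_tensor] Quotient3_rel_rep[OF Quotient3_tensor]
    by (metis Quotient3_abs_rep[OF Quotient3_tensor] tensor.abs_eq_iff)
  then have "?f (rep_tensor (abs_tensor p) - p) \<in> cvec.span {0}"
    by (rule clinear_span[OF clinear_lin_ext, rotated]) (simp add: * cvec.span_zero)
  then show ?thesis by (simp add: tlift_def clinear_diff[OF clinear_lin_ext])
qed

lemma clinear_tlift:
  assumes "cbilinear \<phi>" shows "clinear (tlift \<phi>)"
proof (rule clinearI)
  fix x y :: "('a, 'b) tensor" and c
  obtain p q where "x = abs_tensor p" "y = abs_tensor q" by (metis Quotient3_abs_rep[OF Quotient3_tensor])
  then show "tlift \<phi> (x + y) = tlift \<phi> x + tlift \<phi> y" "tlift \<phi> (c *\<^sub>C x) = c *\<^sub>C tlift \<phi> x"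
    by (simp_all add: tlift_abs[OF assms] plus_tensor.abs_eq scaleC_tensor.abs_eq
        clinear_add[OF clinear_lin_ext] clinear_scale[OF clinear_lin_ext])
qed

lemma tlift_tens [simp]: "cbilinear \<phi> \<Longrightarrow> tlift \<phi> (a \<otimes> b) = \<phi> a b"
  by (simp add: tens.abs_eq tlift_abs)

lemma tlift_fun_add: "tlift (\<lambda>a b. \<phi> a b + \<psi> a b) x = tlift \<phi> x + tlift \<psi> x"
  by (simp add: tlift_def lin_ext_def case_prod_unfold scaleC_add_right sum.distrib)

lemma tlift_fun_scale: "tlift (\<lambda>a b. c *\<^sub>C \<phi> a b) x = c *\<^sub>C tlift \<phi> x"
  by (simp add: tlift_def lin_ext_def case_prod_unfold cvec.scale_sum_right mult.commute)

lemma tensor_induct: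
  assumes "\<And>a b. P (a \<otimes> b)" "\<And>x y. P x \<Longrightarrow> P y \<Longrightarrow> P (x + y)"
  shows "P x"
proof -
  define p where "p = rep_tensor x"
  have x: "x = abs_tensor p" by (simp add: p_def Quotient3_abs_rep[OF Quotient3_tensor])
  have "P (\<Sum>k\<in>S. abs_tensor (Poly_Mapping.lookup p k *\<^sub>C Poly_Mapping.single k 1))"
    if "finite S" for S
    using that
  proof (induction S)
    case empty
    have "P (0 \<otimes> 0)" by (rule assms)
    then show ?case by simp
  next
    case (insert k S)
    obtain a b where k: "k = (a, b)" by fastforce
    have "abs_tensor (Poly_Mapping.lookup p k *\<^sub>C Poly_Mapping.single k 1)
        = (Poly_Mapping.lookup p k *\<^sub>C a) \<otimes> b"
      by (simp only: k tens_scale_left tens.abs_eq[symmetric] scaleC_tensor.abs_eq[symmetric])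
    then show ?case using insert assms by simp
  qed
  from this[of "Poly_Mapping.keys p"]
  have "P (\<Sum>k\<in>Poly_Mapping.keys p. abs_tensor (Poly_Mapping.lookup p k *\<^sub>C Poly_Mapping.single k 1))"
    by simp
  moreover have "(\<Sum>k\<in>S. abs_tensor (f k)) = abs_tensor (\<Sum>k\<in>S. f k)"
    for S and f :: "'a \<times> 'b \<Rightarrow> 'a \<times> 'b \<Rightarrow>\<^sub>0 complex"
    by (induction S rule: infinite_finite_induct)
      (simp_all add: zero_tensor.abs_eq plus_tensor.abs_eq)
  ultimately have "P (abs_tensor p)"
    using lin_ext_single_id[of p] by (simp only: lin_ext_def)
  then show ?thesis by (simp add: x)
qed

definition tmap :: "('a::complex_vector \<Rightarrow> 'c::complex_vector) \<Rightarrow>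
    ('b::complex_vector \<Rightarrow> 'd::complex_vector) \<Rightarrow> ('a, 'b) tensor \<Rightarrow> ('c, 'd) tensor"
  where "tmap f g = tlift (\<lambda>a b. f a \<otimes> g b)"

definition tassoc :: "(('a::complex_vector, 'b::complex_vector) tensor, 'c::complex_vector) tensor \<Rightarrow>
    ('a, ('b, 'c) tensor) tensor"
  where "tassoc = tlift (\<lambda>x c. tlift (\<lambda>a b. a \<otimes> (b \<otimes> c)) x)"

text \<open>The product on the tensor product of superalgebras obeys the sign rule
  \<open>(a \<otimes> h) (b \<otimes> k) = (-1)\<^bsup>|h| |b|\<^esup> a b \<otimes> h k\<close> for homogeneous \<open>h\<close> and \<open>b\<close>.\<close>

definition super_mult :: "'a::superalgebra \<Rightarrow> 'b::superalgebra \<Rightarrow> 'a \<Rightarrow> 'b \<Rightarrow> ('a, 'b) tensor"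
  where "super_mult a h b k =
    (\<Sum>i\<in>{0, 1}. \<Sum>j\<in>{0, 1}. koszul i j *\<^sub>C ((a * spart j b) \<otimes> (spart i h * k)))"

definition tensor_part :: "bit \<Rightarrow> 'a::superalgebra \<Rightarrow> 'b::superalgebra \<Rightarrow> ('a, 'b) tensor"
  where "tensor_part n a h = (\<Sum>i\<in>{0, 1}. spart i a \<otimes> spart (n - i) h)"

instantiation tensor :: (superalgebra, superalgebra) superalgebra
begin
definition one_tensor :: "('a, 'b) tensor" where "1 = 1 \<otimes> 1"
definition times_tensor :: "('a, 'b) tensor \<Rightarrow> ('a, 'b) tensor \<Rightarrow> ('a, 'b) tensor"
  where "x * y = tlift (\<lambda>a h. tlift (super_mult a h) y) x"
definition spart_tensor :: "bit \<Rightarrow> ('a, 'b) tensor \<Rightarrow> ('a, 'b) tensor"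
  where "spart n = tlift (tensor_part n)"

lemma super_mult_bilinear: "cbilinear (super_mult a h :: 'a \<Rightarrow> 'b \<Rightarrow> _)"
  by (rule cbilinearI) (simp_all add: super_mult_def spart_add spart_scaleC distrib_left
      tens_simps scaleC_add_right mult.commute)

lemma times_bilinear: "cbilinear (\<lambda>a h. tlift (super_mult a h) (y :: ('a, 'b) tensor))"
proof -
  have "super_mult (a + a') h = (\<lambda>b k. super_mult a h b k + super_mult a' h b k)"
    "super_mult a (h + h') = (\<lambda>b k. super_mult a h b k + super_mult a h' b k)"
    "super_mult (c *\<^sub>C a) h = (\<lambda>b k. c *\<^sub>C super_mult a h b k)"
    "super_mult a (c *\<^sub>C h) = (\<lambda>b k. c *\<^sub>C super_mult a h b k)" for a a' :: 'a and h h' :: 'b and c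
    by (simp_all add: super_mult_def spart_add spart_scaleC distrib_right fun_eq_iff
      tens_simps scaleC_add_right mult.commute)
  then show ?thesis by (intro cbilinearI) (simp_all only: tlift_fun_add tlift_fun_scale)
qed

lemma part_bilinear: "cbilinear (tensor_part n :: 'a \<Rightarrow> 'b \<Rightarrow> _)"
  by (rule cbilinearI) (simp_all add: tensor_part_def spart_add spart_scaleC
      tens_simps scaleC_add_right)

lemma times_left: "clinear (\<lambda>x. x * y)" for y :: "('a, 'b) tensor"
  unfolding times_tensor_def by (rule clinear_tlift[OF times_bilinear])

lemma times_right: "clinear (\<lambda>y. x * y)" for x :: "('a, 'b) tensor"
  by (rule clinearI; unfold times_tensor_def)
     (simp_all add: clinear_add[OF clinear_tlift[OF super_mult_bilinear]] tlift_fun_add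
      clinear_scale[OF clinear_tlift[OF super_mult_bilinear]] tlift_fun_scale)

lemma spart_linear: "clinear (spart n :: ('a, 'b) tensor \<Rightarrow> _)"
  unfolding spart_tensor_def by (rule clinear_tlift[OF part_bilinear])

lemma times_tens: "(a \<otimes> h) * (b \<otimes> k) = super_mult a h b k" for a b :: 'a and h k :: 'b
  unfolding times_tensor_def
  by (subst tlift_tens[OF times_bilinear]) (rule tlift_tens[OF super_mult_bilinear])

lemma spart_tens: "spart n (a \<otimes> h) = tensor_part n a h" for a :: 'a and h :: 'b
  by (simp add: spart_tensor_def part_bilinear)

lemma times_hom:
  fixes a b :: 'a and h k :: 'b
  assumes "spart m h = h" "spart n b = b"
  shows "(a \<otimes> h) * (b \<otimes> k) = koszul m n *\<^sub>C ((a * b) \<otimes> (h * k))"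
proof -
  have "spart i h = (if i = m then h else 0)" "spart i b = (if i = n then b else 0)" for i
    using spart_spart[of i m h] spart_spart[of i n b] assms by auto
  then show ?thesis by (cases m; cases n; simp add: times_tens super_mult_def)
qed

lemma spart_hom:
  fixes a :: 'a and h :: 'b
  assumes "spart m a = a" "spart n h = h"
  shows "spart i (a \<otimes> h) = (if i = m + n then a \<otimes> h else 0)"
proof -
  have "spart i a = (if i = m then a else 0)" "spart i h = (if i = n then h else 0)" for i
    using spart_spart[of i m a] spart_spart[of i n h] assms by auto
  then show ?thesis by (cases m; cases n; cases i; simp add: spart_tens tensor_part_def)
qed

lemma tensor_hom_induct:
  fixes x :: "('a, 'b) tensor"
  assumes hom: "\<And>m n a h. spart m a = a \<Longrightarrow> spart n h = h \<Longrightarrow> P (a \<otimes> h)"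
    and add: "\<And>x y. P x \<Longrightarrow> P y \<Longrightarrow> P (x + y)"
  shows "P x"
proof (induction x rule: tensor_induct)
  case (1 a h)
  have "P (spart i a \<otimes> spart j h)" for i j by (rule hom[of i _ j]) (simp_all add: spart_spart)
  moreover have "a \<otimes> h = (spart 0 a + spart 1 a) \<otimes> (spart 0 h + spart 1 h)"
    by (simp only: spart_decomp)
  ultimately show ?case by (simp add: tens_simps add)
next
  case (2 x y)
  then show ?case by (rule add)
qed

instance
proof
  fix x y z :: "('a, 'b) tensor" and c :: complex and i j :: bit
  note [simp] = clinear_add[OF times_left] clinear_add[OF times_right] clinear_add[OF spart_linear]
    clinear_scale[OF times_left] clinear_scale[OF times_right] clinear_scale[OF spart_linear]
    clinear_zero[OF times_left] clinear_zero[OF times_right] clinear_zero[OF spart_linear]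
    clinear_neg[OF times_left] clinear_neg[OF times_right]
  show "(x + y) * z = x * z + y * z" "x * (y + z) = x * y + x * z" by simp_all
  show "(c *\<^sub>C x) * y = c *\<^sub>C (x * y)" "x * (c *\<^sub>C y) = c *\<^sub>C (x * y)" by simp_all
  show "spart i (x + y) = spart i x + spart i y" "spart i (c *\<^sub>C x) = c *\<^sub>C spart i x" by simp_all
  show "1 * x = x"
  proof (induction x rule: tensor_hom_induct)
    case (1 m n a h)
    then show ?case by (cases m; simp add: one_tensor_def times_hom[OF spart_one] koszul_def)
  qed simp
  show "x * 1 = x"
  proof (induction x rule: tensor_hom_induct)
    case (1 m n a h)
    then show ?case by (simp add: one_tensor_def times_hom[OF _ spart_one] koszul_def)
  qed simp
  show "spart i (spart j x) = (if i = j then spart j x else 0)"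
  proof (induction x rule: tensor_hom_induct)
    case (1 m n a h)
    then show ?case by (simp add: spart_hom)
  qed simp
  show "spart 0 x + spart 1 x = x"
  proof (induction x rule: tensor_hom_induct)
    case (1 m n a h)
    then show ?case by (cases m; cases n; simp add: spart_hom)
  next
    case (2 x y)
    then show ?case by (simp add: algebra_simps)
  qed
  have mhom: "spart (m + n) (a * b) = a * b" if "spart m a = a" "spart n b = b"
    for a b :: "'c::superalgebra" and m n
    using spart_mult[of m n a b] that by simp
  show "spart (i + j) (spart i x * spart j y) = spart i x * spart j y"
  proof (induction x rule: tensor_hom_induct)
    case (1 m n a h)
    note ah = this
    show ?case
    proof (induction y rule: tensor_hom_induct)
      case (1 m' n' b k)
      have "spart (i + j) ((a * b) \<otimes> (h * k)) = (a * b) \<otimes> (h * k)"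
        if "i = m + n" "j = m' + n'"
      proof -
        have "i + j = (m + m') + (n + n')" using that by (simp only: add_ac)
        then show ?thesis
          by (simp only: spart_hom[OF mhom[OF ah(1) 1(1)] mhom[OF ah(2) 1(2)]] if_True simp_thms)
      qed
      then show ?case using ah 1 by (auto simp: spart_hom times_hom)
    qed simp
  qed simp
  show "x * y * z = x * (y * z)"
  proof (induction x rule: tensor_hom_induct)
    case (1 m n a h)
    note ah = this
    show ?case
    proof (induction y rule: tensor_hom_induct)
      case (1 m' n' b k)
      note bk = this
      show ?case
      proof (induction z rule: tensor_hom_induct)
        case (1 m'' n'' c l)
        have k: "koszul n m' * koszul (n + n') m'' = koszul n' m'' * koszul n (m' + m'')"
          by (cases n; cases n'; cases m'; cases m''; simp add: koszul_def)
        show ?case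
          by (simp only: times_hom[OF ah(2) bk(1)] times_hom[OF bk(2) 1(1)]
              clinear_scale[OF times_left] clinear_scale[OF times_right] scaleC_scaleC
              times_hom[OF mhom[OF ah(2) bk(2)] 1(1)] times_hom[OF ah(2) mhom[OF bk(1) 1(1)]]
              k mult.assoc)
      qed simp
    qed simp
  qed simp
qed
end

section \<open>Hopf superalgebras and Hopf--Galois extensions\<close>

definition hopf_superalgebra ::
    "('h::superalgebra \<Rightarrow> ('h, 'h) tensor) \<Rightarrow> ('h \<Rightarrow> complex) \<Rightarrow> ('h \<Rightarrow> 'h) \<Rightarrow> bool"
  where "hopf_superalgebra \<Delta> \<epsilon> S \<longleftrightarrow>
    superalgebra_hom \<Delta> \<and> superalgebra_hom \<epsilon> \<and> super_linear S \<and>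
    (\<forall>x. tassoc (tmap \<Delta> id (\<Delta> x)) = tmap id \<Delta> (\<Delta> x)) \<and>
    (\<forall>x. tlift (\<lambda>a b. \<epsilon> a *\<^sub>C b) (\<Delta> x) = x) \<and>
    (\<forall>x. tlift (\<lambda>a b. \<epsilon> b *\<^sub>C a) (\<Delta> x) = x) \<and>
    (\<forall>x. tlift (\<lambda>a b. S a * b) (\<Delta> x) = \<epsilon> x *\<^sub>C 1) \<and>
    (\<forall>x. tlift (\<lambda>a b. a * S b) (\<Delta> x) = \<epsilon> x *\<^sub>C 1)"

definition comodule_superalgebra ::
    "('h::superalgebra \<Rightarrow> ('h, 'h) tensor) \<Rightarrow> ('h \<Rightarrow> complex) \<Rightarrow>
     ('a::superalgebra \<Rightarrow> ('a, 'h) tensor) \<Rightarrow> bool"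
  where "comodule_superalgebra \<Delta> \<epsilon> \<delta> \<longleftrightarrow>
    superalgebra_hom \<delta> \<and>
    (\<forall>a. tassoc (tmap \<delta> id (\<delta> a)) = tmap id \<Delta> (\<delta> a)) \<and>
    (\<forall>a. tlift (\<lambda>b h. \<epsilon> h *\<^sub>C b) (\<delta> a) = a)"

definition coinvariants :: "('a::superalgebra \<Rightarrow> ('a, 'h::superalgebra) tensor) \<Rightarrow> 'a set"
  where "coinvariants \<delta> = {a. \<delta> a = a \<otimes> 1}"

text \<open>For a subalgebra \<open>B\<close> of \<open>A\<close>, the balanced tensor product \<open>A \<otimes>\<^sub>B A\<close> is the quotient
  of \<open>A \<otimes> A\<close> by the span of all \<open>ab \<otimes> c - a \<otimes> bc\<close>; its elements are the cosets.\<close>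

definition balanced_rel :: "'a::superalgebra set \<Rightarrow> (('a, 'a) tensor \<times> ('a, 'a) tensor) set"
  where "balanced_rel B =
    {(x, y). x - y \<in> cvec.span {(a * b) \<otimes> c - a \<otimes> (b * c) | a b c. b \<in> B}}"

definition balanced_tensor :: "'a::superalgebra set \<Rightarrow> ('a, 'a) tensor set set"
  where "balanced_tensor B = UNIV // balanced_rel B"

text \<open>\<open>a \<otimes> c \<mapsto> (m \<otimes> id) (a \<otimes> \<delta> c)\<close> on \<open>A \<otimes> A\<close>, and the map it induces on cosets.\<close>

definition canonical_lift ::
    "('a::superalgebra \<Rightarrow> ('a, 'h::superalgebra) tensor) \<Rightarrow> ('a, 'a) tensor \<Rightarrow> ('a, 'h) tensor"
  where "canonical_lift \<delta> = tlift (\<lambda>a c. tlift (\<lambda>b h. (a * b) \<otimes> h) (\<delta> c))"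

definition canonical_map ::
    "('a::superalgebra \<Rightarrow> ('a, 'h::superalgebra) tensor) \<Rightarrow> ('a, 'a) tensor set \<Rightarrow> ('a, 'h) tensor"
  where "canonical_map \<delta> X = the_elem (canonical_lift \<delta> ` X)"

definition hopf_galois ::
    "('h::superalgebra \<Rightarrow> ('h, 'h) tensor) \<Rightarrow> ('h \<Rightarrow> complex) \<Rightarrow> ('h \<Rightarrow> 'h) \<Rightarrow>
     ('a::superalgebra \<Rightarrow> ('a, 'h) tensor) \<Rightarrow> bool"
  where "hopf_galois \<Delta> \<epsilon> S \<delta> \<longleftrightarrow>
    hopf_superalgebra \<Delta> \<epsilon> S \<and> comodule_superalgebra \<Delta> \<epsilon> \<delta> \<and>
    bij_betw (canonical_map \<delta>) (balanced_tensor (coinvariants \<delta>)) UNIV"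

definition convolution ::
    "('h::superalgebra \<Rightarrow> ('h, 'h) tensor) \<Rightarrow> ('h \<Rightarrow> 'a::superalgebra) \<Rightarrow> ('h \<Rightarrow> 'a) \<Rightarrow> 'h \<Rightarrow> 'a"
  where "convolution \<Delta> j h x = tlift (\<lambda>a b. j a * h b) (\<Delta> x)"

definition cleaving_map ::
    "('h::superalgebra \<Rightarrow> ('h, 'h) tensor) \<Rightarrow> ('h \<Rightarrow> complex) \<Rightarrow>
     ('a::superalgebra \<Rightarrow> ('a, 'h) tensor) \<Rightarrow> ('h \<Rightarrow> 'a) \<Rightarrow> bool"
  where "cleaving_map \<Delta> \<epsilon> \<delta> j \<longleftrightarrow>
    super_linear j \<and> (\<forall>x. \<delta> (j x) = tmap j id (\<Delta> x)) \<and>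
    (\<exists>h. super_linear h \<and>
      (\<forall>x. convolution \<Delta> j h x = \<epsilon> x *\<^sub>C 1) \<and> (\<forall>x. convolution \<Delta> h j x = \<epsilon> x *\<^sub>C 1))"

definition trivial_hopf_galois ::
    "('h::superalgebra \<Rightarrow> ('h, 'h) tensor) \<Rightarrow> ('h \<Rightarrow> complex) \<Rightarrow> ('h \<Rightarrow> 'h) \<Rightarrow>
     ('a::superalgebra \<Rightarrow> ('a, 'h) tensor) \<Rightarrow> bool"
  where "trivial_hopf_galois \<Delta> \<epsilon> S \<delta> \<longleftrightarrow>
    hopf_galois \<Delta> \<epsilon> S \<delta> \<and> (\<exists>j. cleaving_map \<Delta> \<epsilon> \<delta> j)"

section \<open>The superalgebras of the chiral Minkowski superspace\<close>

text \<open>\<open>pgen x\<close> is the class of the generator \<open>x\<close>; \<open>pres_lift f\<close> is the morphism sending each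
  generator \<open>x\<close> to \<open>f x\<close>, provided \<open>f\<close> respects the parities and the defining relations
  (see \<open>pres_lift_hom\<close> and \<open>pres_lift_gen\<close>).\<close>

definition pgen :: "'g::presentation \<Rightarrow> 'g pres_alg"
  where "pgen x = abs_pres_alg (fgen x)"

definition free_lift :: "('g \<Rightarrow> 'b::superalgebra) \<Rightarrow> 'g free_alg \<Rightarrow> 'b"
  where "free_lift f = lin_ext (\<lambda>w. prod_list (map f (letters w)))"

definition pres_lift :: "('g::presentation \<Rightarrow> 'b::superalgebra) \<Rightarrow> 'g pres_alg \<Rightarrow> 'b"
  where "pres_lift f x = free_lift f (rep_pres_alg x)"

lemma clinear_free_lift: "clinear (free_lift f)"
  unfolding free_lift_def by (rule clinear_lin_ext)

lemma free_lift_one [simp]: "free_lift f 1 = 1"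
  by (simp add: free_lift_def zero_word_def flip: single_one)

lemma free_lift_fgen [simp]: "free_lift f (fgen x) = f x"
  by (simp add: free_lift_def fgen_def)

lemma free_alg_induct:
  assumes "\<And>w c. P (Poly_Mapping.single w (c::complex))" "\<And>p q. P p \<Longrightarrow> P q \<Longrightarrow> P (p + q)"
  shows "P (p :: 'g free_alg)"
proof -
  have "P (\<Sum>x\<in>S. Poly_Mapping.lookup p x *\<^sub>C Poly_Mapping.single x 1)" for S
  proof (induction S rule: infinite_finite_induct)
    case (insert x S)
    then show ?case by (simp add: assms scale_single)
  qed (use assms(1)[of 0 0] in simp_all)
  from this[of "Poly_Mapping.keys p"] show ?thesis
    using lin_ext_single_id[of p] by (simp only: lin_ext_def)
qed

lemma free_lift_mult: "free_lift f (p * q) = free_lift f p * free_lift f q"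
proof (induction p rule: free_alg_induct)
  case (1 v c)
  show ?case
  proof (induction q rule: free_alg_induct)
    case (1 w d)
    show ?case by (simp add: free_lift_def mult_single plus_word_def mult.commute)
  next
    case (2 q q')
    then show ?case by (simp add: distrib_left clinear_add[OF clinear_free_lift])
  qed
next
  case (2 p p')
  then show ?case by (simp add: distrib_right clinear_add[OF clinear_free_lift])
qed

text \<open>Compatibility of an assignment on generators with parities and defining relations.\<close>

definition respects_relations :: "('g::presentation \<Rightarrow> 'b::superalgebra) \<Rightarrow> bool"
  where "respects_relations f \<longleftrightarrow>
    (\<forall>x. spart (gpar x) (f x) = f x) \<and>
    (\<forall>x y. f x * f y = koszul (gpar x) (gpar y) *\<^sub>C (f y * f x)) \<and>
    (\<forall>r\<in>grel. free_lift f r = 0)"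

lemma pres_lift_abs:
  assumes "respects_relations f"
  shows "pres_lift f (abs_pres_alg p) = free_lift f p"
proof -
  have *: "free_lift f (a * r * b) = 0" if r: "r \<in> super_relations" for a r b
  proof -
    consider x y where "r = fgen x * fgen y - koszul (gpar x) (gpar y) *\<^sub>C (fgen y * fgen x)"
      | "r \<in> grel" using r unfolding super_relations_def by blast
    then have "free_lift f r = 0"
    proof cases
      case 1
      have "f x * f y = koszul (gpar x) (gpar y) *\<^sub>C (f y * f x)"
        using assms unfolding respects_relations_def by blast
      then show ?thesis
        by (simp only: 1 clinear_diff[OF clinear_free_lift] clinear_scale[OF clinear_free_lift]
            free_lift_mult free_lift_fgen diff_self)
    qed (use assms in \<open>simp add: respects_relations_def\<close>)
    then show ?thesis by (simp add: free_lift_mult)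
  qed
  have "rep_pres_alg (abs_pres_alg p) - p \<in> relation_ideal"
    by (metis Quotient3_abs_rep[OF Quotient3_pres_alg] pres_alg.abs_eq_iff)
  then have "free_lift f (rep_pres_alg (abs_pres_alg p) - p) \<in> cvec.span {0}"
    unfolding relation_ideal_def
    by (rule clinear_span[OF clinear_free_lift, rotated]) (auto simp: * cvec.span_zero)
  then show ?thesis by (simp add: pres_lift_def clinear_diff[OF clinear_free_lift])
qed

lemma pres_lift_gen: "respects_relations f \<Longrightarrow> pres_lift f (pgen x) = f x"
  by (simp add: pgen_def pres_lift_abs)

lemma free_lift_part:
  assumes "respects_relations f"
  shows "free_lift f (fpart i p) = spart i (free_lift f p)"
proof (induction p rule: free_alg_induct)
  case (1 w c)
  have "spart (sum_list (map gpar xs)) (prod_list (map f xs)) = prod_list (map f xs)" for xs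
  proof (induction xs)
    case Nil then show ?case by (simp add: spart_one)
  next
    case (Cons x xs)
    have "spart (gpar x) (f x) = f x" using assms by (simp add: respects_relations_def)
    then show ?case
      using spart_mult[of "gpar x" "sum_list (map gpar xs)" "f x" "prod_list (map f xs)"] Cons
      by (simp only: list.map sum_list.Cons prod_list.Cons)
  qed
  from this[of "letters w"]
  have h: "spart (wpar w) (prod_list (map f (letters w))) = prod_list (map f (letters w))"
    by (simp add: wpar_def)
  have "fpart i (Poly_Mapping.single w c) = (if i = wpar w then Poly_Mapping.single w c else 0)"
    by (rule poly_mapping_eqI) (auto simp: fpart.rep_eq lookup_single when_def)
  moreover have "spart i (prod_list (map f (letters w)))
      = (if i = wpar w then prod_list (map f (letters w)) else 0)"
    using spart_spart[of i "wpar w" "prod_list (map f (letters w))"] h by simp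
  ultimately show ?case
    by (simp add: free_lift_def spart_scaleC clinear_zero[OF clinear_lin_ext])
next
  case (2 p q)
  then show ?case by (simp add: clinear_add[OF clinear_fpart] clinear_add[OF clinear_free_lift] spart_add)
qed

lemma pres_lift_hom:
  assumes "respects_relations f" shows "superalgebra_hom (pres_lift f)"
proof -
  have abs: "\<exists>p. x = abs_pres_alg p" for x :: "'a pres_alg"
    by (metis Quotient3_abs_rep[OF Quotient3_pres_alg])
  note [simp] = pres_lift_abs[OF assms] plus_pres_alg.abs_eq times_pres_alg.abs_eq
    scaleC_pres_alg.abs_eq spart_pres_alg.abs_eq one_pres_alg.abs_eq
  have "pres_lift f (x + y) = pres_lift f x + pres_lift f y"
    "pres_lift f (x * y) = pres_lift f x * pres_lift f y"
    "pres_lift f (c *\<^sub>C x) = c *\<^sub>C pres_lift f x"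
    "pres_lift f (spart i x) = spart i (pres_lift f x)" for x y c i
    using abs[of x] abs[of y]
    by (auto simp: clinear_add[OF clinear_free_lift] clinear_scale[OF clinear_free_lift]
        free_lift_mult free_lift_part[OF assms])
  then show ?thesis
    by (simp add: superalgebra_hom_def super_linear_def clinear_iff)
qed

text \<open>Indices 1, 2 (and 3, 4) are the numerals of the types \<open>2\<close> and \<open>4\<close>, where \<open>2 = 0\<close> and
  \<open>4 = 0\<close> are the last elements.  \<open>S_a i j\<close> is \<open>a\<^sub>i\<^sub>j\<close>; the odd rows 5, 6 are indexed by
  \<open>k :: 2\<close>, so \<open>S_alpha k l\<close> is \<open>\<alpha>\<^sub>4\<^sub>+\<^sub>k\<^sub>,\<^sub>l\<close>; likewise \<open>M_u i j\<close> is \<open>u\<^sub>2\<^sub>+\<^sub>i\<^sub>,\<^sub>j\<close> and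
  \<open>M_nu k l\<close> is \<open>\<nu>\<^sub>4\<^sub>+\<^sub>k\<^sub>,\<^sub>l\<close>.  \<open>S_T\<close> and \<open>GL_T\<close> are the inverses of the determinants.\<close>

datatype S_gen = S_a "4" "2" | S_alpha "2" "2" | S_T
datatype GL_gen = GL_g "2" "2" | GL_T
datatype M_gen = M_u "2" "2" | M_nu "2" "2"

instantiation S_gen :: presentation
begin
definition gpar_S_gen :: "S_gen \<Rightarrow> bit"
  where "gpar_S_gen x = (case x of S_alpha k l \<Rightarrow> 1 | _ \<Rightarrow> 0)"
definition grel_S_gen :: "S_gen free_alg set"
  where "grel_S_gen =
    {(fgen (S_a 1 1) * fgen (S_a 2 2) - fgen (S_a 1 2) * fgen (S_a 2 1)) * fgen S_T - 1}"
instance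
proof
  fix r :: "S_gen free_alg" assume "r \<in> grel"
  then have r: "r = Poly_Mapping.single (Word [S_a 1 1, S_a 2 2, S_T]) 1
      - Poly_Mapping.single (Word [S_a 1 2, S_a 2 1, S_T]) 1 - Poly_Mapping.single (Word []) 1"
    by (simp add: grel_S_gen_def fgen_def mult_single plus_word_def left_diff_distrib
        zero_word_def flip: single_one)
  show "\<exists>i. \<forall>w\<in>Poly_Mapping.keys r. sum_list (map gpar (letters w)) = i"
    by (rule exI[of _ 0])
      (auto simp: r gpar_S_gen_def in_keys_iff lookup_minus lookup_single when_def split: if_splits)
qed
end

instantiation GL_gen :: presentation
begin
definition gpar_GL_gen :: "GL_gen \<Rightarrow> bit"
  where "gpar_GL_gen x = 0"
definition grel_GL_gen :: "GL_gen free_alg set"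
  where "grel_GL_gen =
    {(fgen (GL_g 1 1) * fgen (GL_g 2 2) - fgen (GL_g 1 2) * fgen (GL_g 2 1)) * fgen GL_T - 1}"
instance by standard (simp add: gpar_GL_gen_def[abs_def])
end

instantiation M_gen :: presentation
begin
definition gpar_M_gen :: "M_gen \<Rightarrow> bit"
  where "gpar_M_gen x = (case x of M_u i j \<Rightarrow> 0 | M_nu k l \<Rightarrow> 1)"
definition grel_M_gen :: "M_gen free_alg set"
  where "grel_M_gen = {}"
instance by standard (simp add: grel_M_gen_def)
end

type_synonym C_S = "S_gen pres_alg"
type_synonym C_GL2 = "GL_gen pres_alg"
type_synonym C_M = "M_gen pres_alg"

definition GL2_comult :: "C_GL2 \<Rightarrow> (C_GL2, C_GL2) tensor"
  where "GL2_comult = pres_lift (\<lambda>x. case x of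
      GL_g i j \<Rightarrow> \<Sum>m\<in>UNIV. pgen (GL_g i m) \<otimes> pgen (GL_g m j)
    | GL_T \<Rightarrow> pgen GL_T \<otimes> pgen GL_T)"

definition GL2_counit :: "C_GL2 \<Rightarrow> complex"
  where "GL2_counit = pres_lift (\<lambda>x. case x of
      GL_g i j \<Rightarrow> if i = j then 1 else 0
    | GL_T \<Rightarrow> 1)"

text \<open>The antipode is the inverse matrix, the adjugate times \<open>GL_T\<close>; for \<open>i :: 2\<close>, \<open>i + 1\<close> is
  the other index.\<close>

definition GL2_antipode :: "C_GL2 \<Rightarrow> C_GL2"
  where "GL2_antipode = pres_lift (\<lambda>x. case x of
      GL_g i j \<Rightarrow> if i = j then pgen (GL_g (i + 1) (i + 1)) * pgen GL_T
                 else - (pgen (GL_g i j) * pgen GL_T)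
    | GL_T \<Rightarrow> pgen (GL_g 1 1) * pgen (GL_g 2 2) - pgen (GL_g 1 2) * pgen (GL_g 2 1))"

definition S_coaction :: "C_S \<Rightarrow> (C_S, C_GL2) tensor"
  where "S_coaction = pres_lift (\<lambda>x. case x of
      S_a i j \<Rightarrow> \<Sum>m\<in>UNIV. pgen (S_a i m) \<otimes> pgen (GL_g m j)
    | S_alpha k l \<Rightarrow> \<Sum>m\<in>UNIV. pgen (S_alpha k m) \<otimes> pgen (GL_g m l)
    | S_T \<Rightarrow> pgen S_T \<otimes> pgen GL_T)"

end

theory Submission
  imports Defs "HOL-Analysis.Cartesian_Space"
begin

text \<open>
  The upper \<open>2 \<times> 2\<close> block of the generic matrix defines an algebra morphism
  \<open>j : \<complex>[GL\<^sub>2] \<rightarrow> \<complex>[S]\<close> of comodules, with convolution inverse \<open>j \<circ> S\<close>.  The rows of the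
  generic matrix multiplied by the inverse of the upper block are coinvariant, which embeds
  \<open>\<complex>[M]\<close> by some \<open>\<phi>\<close>; setting the upper block to the identity matrix gives a left inverse \<open>\<pi>\<close>
  of \<open>\<phi>\<close>.  The identity \<open>a = \<phi>(\<pi>(a\<^sub>0)) j(a\<^sub>1)\<close>, which holds on generators and hence everywhere,
  shows both that every coinvariant lies in the image of \<open>\<phi>\<close> and that \<open>A \<otimes>\<^sub>B A\<close> is
  spanned by the \<open>a \<otimes> j(x)\<close>.  On these the canonical map is \<open>a \<otimes> x \<mapsto> a j(x\<^sub>1) \<otimes> x\<^sub>2\<close>, which is
  inverted by \<open>a \<otimes> x \<mapsto> a j(S(x\<^sub>1)) \<otimes> x\<^sub>2\<close>.
\<close>

section \<open>Supercommutative superalgebras\<close>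

text \<open>A supercommutative target makes \<open>f a * g b\<close> multiplicative on the tensor
  product (see \<open>tlift_hom\<close>) and the sign condition in \<open>respects_relations\<close>
  automatic. The law is phrased with \<open>spart\<close> because signs make sense only for
  homogeneous elements.\<close>

class supercommutative = superalgebra +
  assumes super_commute:
    "spart i x * spart j y = koszul i j *\<^sub>C (spart j y * spart i x)"

instance complex :: supercommutative
  by standard (auto simp: koszul_def)

lemma even_commute:
  fixes x y :: "'a::supercommutative"
  assumes "spart 0 x = x"
  shows "x * y = y * x"
proof -
  have "x * spart j y = spart j y * x" for j
    using super_commute[of 0 x j y] assms by (simp add: koszul_def)
  then have "x * (spart 0 y + spart 1 y) = (spart 0 y + spart 1 y) * x"
    by (simp only: distrib_left distrib_right)
  then show ?thesis by (simp only: spart_decomp)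
qed

lemma even_left_commute:
  fixes x y z :: "'a::supercommutative"
  assumes "spart 0 x = x"
  shows "x * (y * z) = y * (x * z)"
  using even_commute[OF assms, of y] by (simp flip: mult.assoc)

lemma spart_mult_hom:
  assumes "spart i x = x" "spart j y = y"
  shows "spart (i + j) (x * y) = x * y"
  using spart_mult[of i j x y] assms by simp

lemma even_mult: "spart 0 x = x \<Longrightarrow> spart 0 y = y \<Longrightarrow> spart 0 (x * y) = x * y"
  using spart_mult_hom[of 0 x 0 y] by simp

lemma spart_sum: "spart i (sum f S) = (\<Sum>x\<in>S. spart i (f x :: 'a::superalgebra))"
  by (induction S rule: infinite_finite_induct) (simp_all add: spart_add)

lemma spart_other:
  "spart j x = x \<Longrightarrow> i \<noteq> j \<Longrightarrow> spart i x = 0" for x :: "'a::superalgebra"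
  using spart_spart[of i j x] by simp

text \<open>On homogeneous elementary tensors the sign exponent (m + n)(m' + n') splits into four
  terms: m m' and n n' from commuting inside each factor, n m' and n' m from the product rule on
  tensors.\<close>

instance tensor :: (supercommutative, supercommutative) supercommutative
proof
  fix x y :: "('a, 'b) tensor" and i j
  note lin = spart_add spart_scaleC distrib_left distrib_right scaleC_add_right
  show "spart i x * spart j y = koszul i j *\<^sub>C (spart j y * spart i x)"
  proof (induction x rule: tensor_hom_induct)
    case (1 m n a h)
    note ah = this
    show ?case
    proof (induction y rule: tensor_hom_induct)
      case (1 m' n' b k)
      have "a * b = koszul m m' *\<^sub>C (b * a)" "h * k = koszul n n' *\<^sub>C (k * h)"
        using super_commute[of m a m' b] super_commute[of n h n' k] ah 1 by simp_all
      then have "(a \<otimes> h) * (b \<otimes> k) = koszul (m + n) (m' + n') *\<^sub>C ((b \<otimes> k) * (a \<otimes> h))"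
        by (simp add: times_hom[OF ah(2) 1(1)] times_hom[OF 1(2) ah(1)] tens_simps)
          (cases m; cases n; cases m'; cases n'; simp add: koszul_def)
      then show ?case by (simp add: spart_hom[OF ah] spart_hom[OF 1])
    qed (simp add: lin)
  qed (simp add: lin)
qed

section \<open>Presented superalgebras: induction over words and the sign rule\<close>

lemma abs_pres_alg_cases:
  obtains p where "x = abs_pres_alg p"
  by (metis Quotient3_abs_rep[OF Quotient3_pres_alg])

text \<open>Classes of words span the quotient, and a word arises from the empty one by prepending
  letters, so the multiplicative step involves only left multiplication by a generator.\<close>

lemma pres_alg_induct:
  assumes one: "P 1"
    and gen: "\<And>g x. P x \<Longrightarrow> P (pgen g * x)"
    and scale: "\<And>c x. P x \<Longrightarrow> P (c *\<^sub>C x)"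
    and add: "\<And>x y. P x \<Longrightarrow> P y \<Longrightarrow> P (x + y)"
  shows "P x"
proof -
  have word: "P (abs_pres_alg (Poly_Mapping.single (Word gs) 1))" for gs
  proof (induction gs)
    case Nil
    show ?case using one by (simp add: one_pres_alg.abs_eq zero_word_def flip: single_one)
  next
    case (Cons g gs)
    have "Poly_Mapping.single (Word (g # gs)) 1 = fgen g * Poly_Mapping.single (Word gs) (1::complex)"
      by (simp add: fgen_def mult_single plus_word_def)
    then show ?case using gen[OF Cons, of g]
      by (simp add: pgen_def times_pres_alg.abs_eq)
  qed
  have "P (abs_pres_alg p)" for p
  proof (induction p rule: free_alg_induct)
    case (1 w c)
    have "P (c *\<^sub>C abs_pres_alg (Poly_Mapping.single w 1))"
      using word[of "letters w"] by (intro scale) simp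
    then show ?case by (simp add: scaleC_pres_alg.abs_eq scale_single)
  next
    case (2 p q)
    then show ?case using add by (simp flip: plus_pres_alg.abs_eq)
  qed
  then show ?thesis by (metis abs_pres_alg_cases)
qed

lemma pgen_parity: "spart (gpar g) (pgen g) = pgen g"
proof -
  have "fhom (gpar g) (fgen g)" by (simp add: fhom_def fgen_def wpar_def)
  then show ?thesis by (simp add: pgen_def spart_pres_alg.abs_eq fpart_fhom)
qed

lemma super_relation_zero:
  assumes "r \<in> super_relations"
  shows "abs_pres_alg r = 0"
proof -
  have "1 * r * 1 \<in> relation_ideal"
    unfolding relation_ideal_def using assms by (intro cvec.span_base) blast
  then show ?thesis by (simp add: zero_pres_alg.abs_eq pres_alg.abs_eq_iff)
qed

lemma pgen_super_commute:
  "pgen g * pgen h = koszul (gpar g) (gpar h) *\<^sub>C (pgen h * pgen g)"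
proof -
  let ?r = "fgen g * fgen h - koszul (gpar g) (gpar h) *\<^sub>C (fgen h * fgen g)"
  have "abs_pres_alg ?r = 0"
    by (rule super_relation_zero) (unfold super_relations_def, blast)
  then show ?thesis
    by (simp add: pgen_def times_pres_alg.abs_eq scaleC_pres_alg.abs_eq
        flip: minus_pres_alg.abs_eq)
qed

text \<open>Multiplying by a homogeneous element shifts degrees by its parity; modulo 2, undoing the
  shift is again adding \<open>gpar g\<close>.\<close>

lemma spart_gen_mult:
  "spart i (pgen g * x) = pgen g * spart (i + gpar g) x"
proof -
  have "spart i (pgen g * spart j x) = (if j = i + gpar g then pgen g * spart j x else 0)" for j
    using spart_mult_hom[OF pgen_parity[of g], of j "spart j x"]
      spart_other[of "gpar g + j" "pgen g * spart j x" i]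
    by (cases i; cases j; cases "gpar g") (auto simp: spart_spart)
  note * = this
  have "spart i (pgen g * (spart 0 x + spart 1 x)) = pgen g * spart (i + gpar g) x"
    by (cases "i + gpar g") (simp_all add: distrib_left spart_add *)
  then show ?thesis by (simp only: spart_decomp)
qed

text \<open>The relations impose the sign rule on pairs of generators. Two inductions spread it to
  all elements, first moving a generator past y, then x past y; the signs combine because
  \<open>koszul\<close> is multiplicative in each argument.\<close>

instance pres_alg :: (presentation) supercommutative
proof
  fix x y :: "'a pres_alg" and i j
  \<comment> \<open>The degree j stays arbitrary, since splitting off the generator h replaces it by
    \<open>j + gpar h\<close>.\<close>
  have gen: "pgen g * spart j y = koszul (gpar g) j *\<^sub>C (spart j y * pgen g)" for g :: 'a and j y
  proof (induction y arbitrary: j rule: pres_alg_induct)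
    case 1
    show ?case by (cases j) (simp_all add: spart_one spart_other[OF spart_one] koszul_def)
  next
    case (2 h x)
    have "pgen g * (pgen h * spart (j + gpar h) x)
        = koszul (gpar g) (gpar h) *\<^sub>C (pgen h * (pgen g * spart (j + gpar h) x))"
      by (simp add: pgen_super_commute[of g h] flip: mult.assoc)
    also have "\<dots> = (koszul (gpar g) (gpar h) * koszul (gpar g) (j + gpar h)) *\<^sub>C
        (pgen h * spart (j + gpar h) x * pgen g)"
      by (simp only: 2 mult_scaleC_right scaleC_scaleC mult.assoc)
    also have "koszul (gpar g) (gpar h) * koszul (gpar g) (j + gpar h) = koszul (gpar g) j"
      by (cases "gpar g"; cases "gpar h"; cases j; simp add: koszul_def)
    finally show ?case by (simp only: spart_gen_mult)
  qed (simp_all add: spart_add spart_scaleC distrib_left distrib_right scaleC_add_right mult.commute)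
  show "spart i x * spart j y = koszul i j *\<^sub>C (spart j y * spart i x)"
  proof (induction x arbitrary: i rule: pres_alg_induct)
    case 1
    show ?case by (cases i) (simp_all add: spart_one spart_other[OF spart_one] koszul_def)
  next
    case (2 g x)
    have "pgen g * spart (i + gpar g) x * spart j y
        = koszul (i + gpar g) j *\<^sub>C (pgen g * spart j y * spart (i + gpar g) x)"
      by (simp add: mult.assoc 2)
    also have "\<dots> = (koszul (i + gpar g) j * koszul (gpar g) j) *\<^sub>C
        (spart j y * (pgen g * spart (i + gpar g) x))"
      by (simp only: gen mult_scaleC_left scaleC_scaleC mult.assoc)
    also have "koszul (i + gpar g) j * koszul (gpar g) j = koszul i j"
      by (cases "gpar g"; cases i; cases j; simp add: koszul_def)
    finally show ?case by (simp only: spart_gen_mult)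
  qed (simp_all add: spart_add spart_scaleC distrib_left distrib_right scaleC_add_right mult.commute)
qed

section \<open>Morphisms\<close>

lemma superalgebra_homD:
  assumes "superalgebra_hom f"
  shows "clinear f" "super_linear f" "f (x + y) = f x + f y" "f (c *\<^sub>C x) = c *\<^sub>C f x" "f 0 = 0"
    "f (x - y) = f x - f y" "f (- x) = - f x"
    "f 1 = 1" "f (x * y) = f x * f y" "f (spart i x) = spart i (f x)"
  using assms
  by (simp_all add: superalgebra_hom_def super_linear_def clinear_add clinear_scale clinear_zero
      clinear_diff clinear_neg)

lemma clinear_sum: "clinear f \<Longrightarrow> f (sum g S) = (\<Sum>x\<in>S. f (g x))"
  by (induction S rule: infinite_finite_induct) (simp_all add: clinear_zero clinear_add)

lemma superalgebra_homI:
  assumes "clinear f" "\<And>i x. f (spart i x) = spart i (f x)" "f 1 = 1" "\<And>x y. f (x * y) = f x * f y"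
  shows "superalgebra_hom f"
  using assms by (simp add: superalgebra_hom_def super_linear_def)

lemma superalgebra_hom_comp:
  "superalgebra_hom f \<Longrightarrow> superalgebra_hom g \<Longrightarrow> superalgebra_hom (\<lambda>x. f (g x))"
  by (rule superalgebra_homI) (simp_all add: superalgebra_homD clinear_iff)

lemma superalgebra_hom_id: "superalgebra_hom id" "superalgebra_hom (\<lambda>x. x)"
  by (rule superalgebra_homI; simp add: clinear_iff)+

text \<open>Used to reduce the Hopf, comodule and decomposition identities below to finite
  computations with matrix entries: each is an equality of two morphisms.\<close>

lemma hom_pres_alg_eqI:
  assumes "superalgebra_hom f" "superalgebra_hom f'" "\<And>g. f (pgen g) = f' (pgen g)"
  shows "f x = f' x"
proof (induction x rule: pres_alg_induct)
  case (2 g x)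
  then show ?case
    by (simp only: superalgebra_homD(9)[OF assms(1)] superalgebra_homD(9)[OF assms(2)] assms(3))
qed (simp_all add: superalgebra_homD(3,4,8)[OF assms(1)] superalgebra_homD(3,4,8)[OF assms(2)])

lemma respects_relationsI:
  fixes f :: "'g::presentation \<Rightarrow> 'b::supercommutative"
  assumes "\<And>x. spart (gpar x) (f x) = f x" "\<And>r. r \<in> grel \<Longrightarrow> free_lift f r = 0"
  shows "respects_relations f"
proof -
  have "f x * f y = koszul (gpar x) (gpar y) *\<^sub>C (f y * f x)" for x y
    using super_commute[of "gpar x" "f x" "gpar y" "f y"] assms(1) by simp
  with assms show ?thesis unfolding respects_relations_def by blast
qed

section \<open>Linear maps and morphisms out of tensor products\<close>

lemma cbilinear_mult:
  "clinear f \<Longrightarrow> clinear g \<Longrightarrow> cbilinear (\<lambda>a b. f a * g b :: 'c::superalgebra)"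
  by (rule cbilinearI) (simp_all add: clinear_add clinear_scale distrib_left distrib_right)

lemma tlift_comp:
  assumes "clinear f" "cbilinear \<phi>"
  shows "f (tlift \<phi> x) = tlift (\<lambda>a b. f (\<phi> a b)) x"
proof -
  have b: "cbilinear (\<lambda>a b. f (\<phi> a b))"
    using assms unfolding cbilinear_def clinear_iff by simp
  show ?thesis
    by (induction x rule: tensor_induct)
      (simp_all add: b assms clinear_add[OF assms(1)] clinear_add[OF clinear_tlift[OF b]]
        clinear_add[OF clinear_tlift[OF assms(2)]])
qed

lemma cbilinear_tens:
  "clinear f \<Longrightarrow> clinear g \<Longrightarrow> cbilinear (\<lambda>a b. f a \<otimes> g b)"
  by (rule cbilinearI) (simp_all add: clinear_iff tens_simps)

text \<open>This mapping property makes the tensor product a coproduct in the supercommutative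
  setting. Moving \<open>g h\<close> past \<open>f b\<close> in the target costs exactly the sign
  that the product of tensors prescribes.\<close>

lemma tlift_hom:
  fixes f :: "'a::superalgebra \<Rightarrow> 'c::supercommutative" and g :: "'b::superalgebra \<Rightarrow> 'c"
  assumes f: "superalgebra_hom f" and g: "superalgebra_hom g"
  shows "superalgebra_hom (tlift (\<lambda>a b. f a * g b))"
proof -
  let ?t = "tlift (\<lambda>a b. f a * g b)"
  have b: "cbilinear (\<lambda>a b. f a * g b)"
    using f g by (intro cbilinear_mult superalgebra_homD)
  note lin = clinear_tlift[OF b] and [simp] = tlift_tens[OF b]
  note [simp] = clinear_add[OF lin] clinear_scale[OF lin]
    superalgebra_homD(9)[OF f] superalgebra_homD(9)[OF g]
  show ?thesis
  proof (rule superalgebra_homI[OF lin])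
    show "?t 1 = 1" using f g by (simp add: one_tensor_def superalgebra_homD)
    show "?t (spart i x) = spart i (?t x)" for i x
    proof (induction x rule: tensor_hom_induct)
      case (1 m n a h)
      have fa: "spart m (f a) = f a" "spart n (g h) = g h"
        using superalgebra_homD(10)[OF f, of m a] superalgebra_homD(10)[OF g, of n h] 1 by simp_all
      show ?case
        using spart_mult_hom[OF fa] spart_other[OF spart_mult_hom[OF fa], of i]
        by (simp add: spart_hom[OF 1] clinear_zero[OF lin])
    qed (simp add: spart_add)
    show "?t (x * y) = ?t x * ?t y" for x y
    proof (induction x rule: tensor_hom_induct)
      case (1 m n a h)
      note ah = this
      show ?case
      proof (induction y rule: tensor_hom_induct)
        case (1 m' n' b k)
        have "spart n (g h) = g h" "spart m' (f b) = f b"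
          using superalgebra_homD(10)[OF f, of m' b] superalgebra_homD(10)[OF g, of n h] ah 1
          by simp_all
        then have "g h * f b = koszul n m' *\<^sub>C (f b * g h)"
          using super_commute[of n "g h" m' "f b"] by simp
        then have "g h * (f b * g k) = koszul n m' *\<^sub>C (f b * (g h * g k))"
          by (simp flip: mult.assoc)
        then show ?case by (simp add: times_hom[OF ah(2) 1(1)] mult.assoc)
      qed (simp add: distrib_left)
    qed (simp add: distrib_right)
  qed
qed

lemma tens_mult_left: "(a \<otimes> 1) * (b \<otimes> h) = (a * b) \<otimes> h"
proof -
  have "(a \<otimes> 1) * (b \<otimes> h) = (a * (spart 0 b + spart 1 b)) \<otimes> h"
    by (simp only: times_tens super_mult_def)
      (simp add: spart_one spart_other[OF spart_one] koszul_def distrib_left tens_simps)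
  then show ?thesis by (simp only: spart_decomp)
qed

lemma tens_mult_right: "(a \<otimes> h) * (1 \<otimes> k) = a \<otimes> (h * k)"
proof -
  have "(a \<otimes> h) * (1 \<otimes> k) = a \<otimes> ((spart 0 h + spart 1 h) * k)"
    by (simp only: times_tens super_mult_def)
      (simp add: spart_one spart_other[OF spart_one] koszul_def distrib_right tens_simps)
  then show ?thesis by (simp only: spart_decomp)
qed

lemma inl_hom: "superalgebra_hom (\<lambda>a. a \<otimes> 1)"
proof (rule superalgebra_homI)
  show "spart i x \<otimes> 1 = spart i (x \<otimes> 1)" for i x
    by (cases i) (simp_all add: spart_tens tensor_part_def spart_one spart_other[OF spart_one])
qed (simp_all add: clinear_iff tens_simps one_tensor_def tens_mult_left)

lemma inr_hom: "superalgebra_hom (\<lambda>h. 1 \<otimes> h)"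
proof (rule superalgebra_homI)
  show "1 \<otimes> spart i x = spart i (1 \<otimes> x)" for i x
    by (cases i) (simp_all add: spart_tens tensor_part_def spart_one spart_other[OF spart_one])
qed (simp_all add: clinear_iff tens_simps one_tensor_def tens_mult_right)

text \<open>\<open>f a \<otimes> g b\<close> is the product of \<open>f a \<otimes> 1\<close> and
  \<open>1 \<otimes> g b\<close>, so \<open>tlift_hom\<close> applies to the two inclusions composed
  with f and g.\<close>

lemma tmap_hom:
  fixes f :: "'a::superalgebra \<Rightarrow> 'c::supercommutative" and g :: "'b::superalgebra \<Rightarrow> 'd::supercommutative"
  assumes "superalgebra_hom f" "superalgebra_hom g"
  shows "superalgebra_hom (tmap f g)"
  using tlift_hom[OF superalgebra_hom_comp[OF inl_hom assms(1)] superalgebra_hom_comp[OF inr_hom assms(2)]]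
  by (simp add: tmap_def tens_mult_left)

lemma tmap_tens [simp]: "clinear f \<Longrightarrow> clinear g \<Longrightarrow> tmap f g (a \<otimes> b) = f a \<otimes> g b"
  by (simp add: tmap_def cbilinear_tens)

lemma clinear_tmap: "clinear f \<Longrightarrow> clinear g \<Longrightarrow> clinear (tmap f g)"
  unfolding tmap_def by (intro clinear_tlift cbilinear_tens)

lemma clinear_id: "clinear id"
  by (simp add: clinear_iff)

lemma tmap_id_rules:
  assumes "clinear f"
  shows "tmap f id (a \<otimes> b) = f a \<otimes> b" "tmap id f (c \<otimes> d) = c \<otimes> f d"
    "tmap f id (x + y) = tmap f id x + tmap f id y"
    "tmap id f (u + v) = tmap id f u + tmap id f v"
  using tmap_tens[OF assms clinear_id] tmap_tens[OF clinear_id assms]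
    clinear_add[OF clinear_tmap[OF assms clinear_id]] clinear_add[OF clinear_tmap[OF clinear_id assms]]
  by (simp_all only: id_apply)

lemmas tmap_id_simps [simp] = tmap_id_rules tmap_id_rules[unfolded id_def]

text \<open>Splitting off the last factor brings \<open>tassoc\<close> into the shape
  \<open>f x * g c\<close> that \<open>tlift_hom\<close> handles.\<close>

lemma tassoc_aux: "tlift (\<lambda>a b. a \<otimes> (b \<otimes> c)) x = tlift (\<lambda>a b. a \<otimes> (b \<otimes> 1)) x * (1 \<otimes> (1 \<otimes> c))"
  for c :: "'c::supercommutative" and x :: "('a::supercommutative, 'b::supercommutative) tensor"
proof -
  have b: "cbilinear (\<lambda>(a::'a) (b::'b). a \<otimes> (b \<otimes> c))" for c :: 'c
    by (rule cbilinearI) (simp_all add: tens_simps)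
  show ?thesis
    by (induction x rule: tensor_induct)
      (simp_all add: b clinear_add[OF clinear_tlift[OF b]] tens_mult_right distrib_right)
qed

lemma tassoc_hom:
  "superalgebra_hom (tassoc :: (('a::supercommutative, 'b::supercommutative) tensor,
     'c::supercommutative) tensor \<Rightarrow> _)"
proof -
  have "superalgebra_hom (tlift (\<lambda>(a::'a) (b::'b). a \<otimes> (b \<otimes> (1::'c))))"
    using tlift_hom[OF inl_hom superalgebra_hom_comp[OF inr_hom inl_hom]]
    by (simp add: tens_mult_left)
  then have "superalgebra_hom (tlift (\<lambda>x (c::'c).
      tlift (\<lambda>(a::'a) (b::'b). a \<otimes> (b \<otimes> 1)) x * (1 \<otimes> (1 \<otimes> c))))"
    by (rule tlift_hom) (intro superalgebra_hom_comp[OF inr_hom] inr_hom)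
  then show ?thesis
    unfolding tassoc_def by (simp only: tassoc_aux[symmetric])
qed

text \<open>Shown for plain vector spaces, because the theory of cleft extensions below works with
  superalgebras that may fail to be supercommutative.\<close>

lemma clinear_tassoc: "clinear tassoc"
  and tassoc_tens [simp]: "tassoc ((a \<otimes> b) \<otimes> c) = a \<otimes> (b \<otimes> c)"
proof -
  have b: "cbilinear (\<lambda>(a::'x::complex_vector) (b::'y::complex_vector). a \<otimes> (b \<otimes> c))"
    for c :: "'z::complex_vector"
    by (rule cbilinearI) (simp_all add: tens_simps)
  have *: "cbilinear (\<lambda>x (c::'z::complex_vector).
      tlift (\<lambda>(a::'x::complex_vector) (b::'y::complex_vector). a \<otimes> (b \<otimes> c)) x)"
    by (rule cbilinearI)
      (simp_all add: clinear_add[OF clinear_tlift[OF b]] clinear_scale[OF clinear_tlift[OF b]]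
        tens_add_right tens_scale_right tlift_fun_add tlift_fun_scale)
  show "clinear (tassoc :: (('x::complex_vector, 'y::complex_vector) tensor, 'z::complex_vector) tensor \<Rightarrow> _)"
    unfolding tassoc_def by (rule clinear_tlift[OF *])
  show "tassoc ((a \<otimes> b) \<otimes> c) = a \<otimes> (b \<otimes> c)"
    for a :: "'x::complex_vector" and b :: "'y::complex_vector" and c :: "'z::complex_vector"
    by (simp add: tassoc_def b *)
qed

section \<open>Cleft extensions\<close>

lemma clinear_comp: "clinear f \<Longrightarrow> clinear g \<Longrightarrow> clinear (\<lambda>x. f (g x))"
  by (simp add: clinear_iff)

lemma clinear_mult_left: "clinear (\<lambda>x. a * x)" for a :: "'a::superalgebra"
  by (simp add: clinear_iff distrib_left)

text \<open>\<open>a \<otimes> x \<mapsto> a f(x\<^sub>1) \<otimes> x\<^sub>2\<close> in Sweedler notation.\<close>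

definition conv_act ::
    "('h::superalgebra \<Rightarrow> ('h, 'h) tensor) \<Rightarrow> ('h \<Rightarrow> 'a::superalgebra) \<Rightarrow> ('a, 'h) tensor \<Rightarrow> ('a, 'h) tensor"
  where "conv_act \<Delta> f = tlift (\<lambda>a x. (a \<otimes> 1) * tmap f id (\<Delta> x))"

lemma conv_act_bilinear:
  assumes "clinear \<Delta>" "clinear f"
  shows "cbilinear (\<lambda>a x. (a \<otimes> 1) * tmap f id (\<Delta> x))"
  using clinear_tmap[OF assms(2) clinear_id] assms(1)
  by (intro cbilinear_mult clinear_comp[of "tmap f id" \<Delta>]) (simp_all add: superalgebra_homD[OF inl_hom])

lemma clinear_conv_act: "clinear \<Delta> \<Longrightarrow> clinear f \<Longrightarrow> clinear (conv_act \<Delta> f)"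
  unfolding conv_act_def by (intro clinear_tlift conv_act_bilinear)

lemma conv_act_tens:
  "clinear \<Delta> \<Longrightarrow> clinear f \<Longrightarrow> conv_act \<Delta> f (a \<otimes> x) = (a \<otimes> 1) * tmap f id (\<Delta> x)"
  by (simp add: conv_act_def conv_act_bilinear)

lemma clinear_convolution:
  assumes "clinear \<Delta>" "clinear f" "clinear g"
  shows "clinear (convolution \<Delta> f g)"
  using clinear_comp[OF clinear_tlift[OF cbilinear_mult[OF assms(2,3)]] assms(1)]
  by (simp add: convolution_def[abs_def])

text \<open>In Sweedler notation both sides send a \<otimes> x to a g(x_1) f(x_2) \<otimes> x_3, so
  \<open>conv_act\<close> is a right action of the convolution algebra. No signs occur, as the
  algebra factor is always multiplied from the left by some \<open>a \<otimes> 1\<close>.\<close>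

lemma conv_act_conv_act:
  fixes \<Delta> :: "'h::superalgebra \<Rightarrow> ('h, 'h) tensor"
  assumes D: "clinear \<Delta>" and f: "clinear f" and g: "clinear g"
    and coassoc: "\<And>x. tassoc (tmap \<Delta> id (\<Delta> x)) = tmap id \<Delta> (\<Delta> x)"
  shows "conv_act \<Delta> f (conv_act \<Delta> g z) = conv_act \<Delta> (convolution \<Delta> g f) z"
proof (induction z rule: tensor_induct)
  case (1 a x)
  \<comment> \<open>K sends u \<otimes> (v \<otimes> w) to a g(u) f(v) \<otimes> w. Facts 1 and 3
    write the two sides of the claim as K applied to the two sides of coassociativity.\<close>
  define K where "K = tlift (\<lambda>u (y::('h, 'h) tensor). ((a * g u) \<otimes> 1) * tmap f id y)"
  note tf = clinear_tmap[OF f clinear_id]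
  have b: "cbilinear (\<lambda>u (y::('h, 'h) tensor). ((a * g u) \<otimes> 1) * tmap f id y)"
    by (intro cbilinear_mult clinear_comp[of "\<lambda>x. x \<otimes> 1" "\<lambda>u. a * g u"] clinear_comp[of "\<lambda>x. a * x" g]
        clinear_mult_left g tf superalgebra_homD(1)[OF inl_hom])
  have K: "K (u \<otimes> y) = ((a * g u) \<otimes> 1) * tmap f id y" for u y
    by (simp add: K_def b)
  have linK: "clinear K" unfolding K_def by (rule clinear_tlift[OF b])
  note add = clinear_add[OF linK] clinear_add[OF clinear_conv_act[OF D f]] clinear_add[OF clinear_tassoc]
  have 1: "conv_act \<Delta> f ((a \<otimes> 1) * tmap g id w) = K (tmap id \<Delta> w)" for w
    by (rule tensor_induct[where x = w])
      (simp_all add: add distrib_left g D f K tens_mult_left conv_act_tens)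
  have bgf: "cbilinear (\<lambda>p q. g p * f q)" by (rule cbilinear_mult[OF g f])
  have 2: "(a * tlift (\<lambda>p q. g p * f q) y) \<otimes> v = K (tassoc (y \<otimes> v))" for y v
    by (rule tensor_induct[where x = y])
      (simp_all add: add distrib_left tens_add_left bgf K f tens_mult_left mult.assoc
        clinear_add[OF clinear_tlift[OF bgf]])
  have 3: "(a \<otimes> 1) * tmap (convolution \<Delta> g f) id w = K (tassoc (tmap \<Delta> id w))" for w
    by (rule tensor_induct[where x = w])
      (simp_all add: add distrib_left D f g tens_mult_left clinear_convolution
        flip: 2, simp add: convolution_def)
  show ?case
    by (simp add: conv_act_tens D f g clinear_convolution 1 3 coassoc)
next
  case (2 x y)
  then show ?case
    by (simp add: clinear_add[OF clinear_conv_act[OF D]] f g clinear_convolution[OF D])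
qed

text \<open>The unit of convolution acts as the identity; hence convolution-inverse maps act by
  mutually inverse bijections.\<close>

lemma conv_act_counit:
  assumes D: "clinear \<Delta>" and e: "clinear \<epsilon>"
    and counit: "\<And>x. tlift (\<lambda>a b. \<epsilon> a *\<^sub>C b) (\<Delta> x) = x"
  shows "conv_act \<Delta> (\<lambda>x. \<epsilon> x *\<^sub>C 1) z = z"
proof -
  have lin: "clinear (\<lambda>x. \<epsilon> x *\<^sub>C 1 :: 'b)"
    using e by (simp add: clinear_iff scaleC_add_left)
  have b: "cbilinear (\<lambda>a b. \<epsilon> a *\<^sub>C b)"
    using e by (intro cbilinearI) (simp_all add: clinear_iff scaleC_add_left scaleC_add_right mult.commute)
  have *: "tmap (\<lambda>x. \<epsilon> x *\<^sub>C 1 :: 'b) id w = 1 \<otimes> tlift (\<lambda>a b. \<epsilon> a *\<^sub>C b) w" for w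
    by (rule tensor_induct[where x = w])
      (simp_all add: lin b tens_simps clinear_add[OF clinear_tlift[OF b]])
  show ?thesis
    by (rule tensor_induct[where x = z])
      (simp_all add: conv_act_tens D lin * counit tens_mult_left clinear_add[OF clinear_conv_act[OF D lin]])
qed

text \<open>Writing the inner map as left multiplication by \<open>a \<otimes> 1\<close> lets
  multiplicativity of \<delta> be applied to the canonical map.\<close>

lemma canonical_lift_eq:
  assumes d: "clinear \<delta>"
  shows "clinear (canonical_lift \<delta>)" "canonical_lift \<delta> (a \<otimes> c) = (a \<otimes> 1) * \<delta> c"
proof -
  have ab: "cbilinear (\<lambda>b h. (a * b) \<otimes> h)" for a :: 'a
    using cbilinear_tens[OF clinear_mult_left clinear_id, of a] by simp
  have *: "tlift (\<lambda>b h. (a * b) \<otimes> h) y = (a \<otimes> 1) * y" for a :: 'a and y :: "('a, 'b) tensor"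
    by (rule tensor_induct[where x = y])
      (simp_all add: ab tens_mult_left distrib_left clinear_add[OF clinear_tlift[OF ab]])
  have b: "cbilinear (\<lambda>a c. (a \<otimes> 1) * \<delta> c)"
    by (intro cbilinear_mult d superalgebra_homD(1)[OF inl_hom])
  show "clinear (canonical_lift \<delta>)" "canonical_lift \<delta> (a \<otimes> c) = (a \<otimes> 1) * \<delta> c"
    using clinear_tlift[OF b] by (simp_all add: canonical_lift_def * b)
qed

text \<open>The last hypothesis is the decomposition a = q(a_0) j(a_1) with coinvariant
  coefficients. It makes the image of id \<otimes> j exhaust the balanced tensor product, while
  along id \<otimes> j the canonical map is the invertible
  \<open>conv_act \<Delta> j\<close>.\<close>

theorem cleft_hopf_galois:
  assumes hopf: "hopf_superalgebra \<Delta> \<epsilon> S" and comod: "comodule_superalgebra \<Delta> \<epsilon> \<delta>"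
    and cleaving: "cleaving_map \<Delta> \<epsilon> \<delta> j"
    and q: "clinear q" "\<And>a. q a \<in> coinvariants \<delta>"
    and normal_basis: "\<And>a. tlift (\<lambda>b x. q b * j x) (\<delta> a) = a"
  shows "hopf_galois \<Delta> \<epsilon> S \<delta>"
proof -
  let ?L = "canonical_lift \<delta>" and ?B = "coinvariants \<delta>"
  let ?G = "{(a * b) \<otimes> c - a \<otimes> (b * c) | a b c. b \<in> ?B}"
  let ?N = "cvec.span ?G"
  obtain h where jlin: "clinear j" and jcomod: "\<And>x. \<delta> (j x) = tmap j id (\<Delta> x)"
    and hlin: "clinear h" and jh: "convolution \<Delta> j h = (\<lambda>x. \<epsilon> x *\<^sub>C 1)"
    and hj: "convolution \<Delta> h j = (\<lambda>x. \<epsilon> x *\<^sub>C 1)"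
    using cleaving unfolding cleaving_map_def super_linear_def by blast
  have D: "clinear \<Delta>" and e: "clinear \<epsilon>" and d: "superalgebra_hom \<delta>"
    and coassoc: "\<And>x. tassoc (tmap \<Delta> id (\<Delta> x)) = tmap id \<Delta> (\<Delta> x)"
    and counit: "\<And>x. tlift (\<lambda>a b. \<epsilon> a *\<^sub>C b) (\<Delta> x) = x"
    using hopf comod unfolding hopf_superalgebra_def comodule_superalgebra_def
    by (simp_all add: superalgebra_homD)
  note dlin = superalgebra_homD(1)[OF d]
  note L = canonical_lift_eq[OF dlin]
  note tj = clinear_tmap[OF clinear_id jlin]
  have inv: "conv_act \<Delta> h (conv_act \<Delta> j z) = z" "conv_act \<Delta> j (conv_act \<Delta> h z) = z" for z
    by (simp_all add: conv_act_conv_act[OF D _ _ coassoc] jlin hlin jh hj conv_act_counit[OF D e counit])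
  have Lj: "?L (tmap id j z) = conv_act \<Delta> j z" for z
    by (rule tensor_induct[where x = z])
      (simp_all add: jlin L jcomod conv_act_tens D clinear_add[OF L(1)]
        clinear_add[OF clinear_conv_act[OF D jlin]])
  have bq: "cbilinear (\<lambda>b x. q b * j x)" by (rule cbilinear_mult[OF q(1) jlin])
  \<comment> \<open>Modulo the balancing relations the coinvariant q(b) moves to the left: a
    \<otimes> q(b) j(x) is equivalent to a q(b) \<otimes> j(x). With z = \<open>\<delta> c\<close>
    every a \<otimes> c gets a representative in the image of id \<otimes> j.\<close>
  have tens: "a \<otimes> tlift (\<lambda>b x. q b * j x) z - tmap id j ((a \<otimes> 1) * tmap q id z) \<in> ?N" for a z
  proof (rule tensor_induct[where x = z], goal_cases)
    case (1 b x)
    have "(a * q b) \<otimes> j x - a \<otimes> (q b * j x) \<in> ?N"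
      using q(2) by (intro cvec.span_base) blast
    from cvec.span_neg[OF this] show ?case
      by (simp add: bq q(1) tens_mult_left jlin)
  next
    case (2 x y)
    from cvec.span_add[OF this] show ?case
      by (simp add: clinear_add[OF clinear_tlift[OF bq]] q(1) jlin distrib_left tens_simps algebra_simps)
  qed
  have span: "\<exists>y. x - tmap id j y \<in> ?N" for x
  proof (rule tensor_induct[where x = x], goal_cases)
    case (1 a c)
    have "a \<otimes> c - tmap id j ((a \<otimes> 1) * tmap q id (\<delta> c)) \<in> ?N"
      using tens[of a "\<delta> c"] by (simp only: normal_basis)
    then show ?case by blast
  next
    case (2 x x')
    then obtain y y' where "x - tmap id j y \<in> ?N" "x' - tmap id j y' \<in> ?N" by blast
    from cvec.span_add[OF this] have "x + x' - tmap id j (y + y') \<in> ?N"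
      by (simp add: clinear_add[OF tj] algebra_simps)
    then show ?case by blast
  qed
  \<comment> \<open>For coinvariant b, multiplicativity gives \<delta>(b c) = (b \<otimes> 1)
    \<delta>(c), so the lift kills the balancing relations.\<close>
  have LN: "?L x = 0" if "x \<in> ?N" for x
  proof -
    have G: "?L g \<in> cvec.span {0}" if gG: "g \<in> ?G" for g
    proof -
      obtain a b c where g: "g = (a * b) \<otimes> c - a \<otimes> (b * c)" and b: "b \<in> ?B"
        using gG by blast
      have "\<delta> b = b \<otimes> 1" using b by (simp add: coinvariants_def)
      then have "?L g = 0"
        by (simp add: g L(2) clinear_diff[OF L(1)] superalgebra_homD(9)[OF d] tens_mult_left
            flip: mult.assoc)
      then show ?thesis by simp
    qed
    from clinear_span[OF L(1) G that] show ?thesis by simp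
  qed
  \<comment> \<open>Conversely, x is equivalent to some \<open>tmap id j y\<close>, whose lift is
    \<open>conv_act \<Delta> j y\<close>; if this vanishes, invertibility of the action forces y =
    0.\<close>
  have ker: "x \<in> ?N \<longleftrightarrow> ?L x = 0" for x
  proof
    assume 0: "?L x = 0"
    obtain y where y: "x - tmap id j y \<in> ?N" using span by blast
    have "conv_act \<Delta> j y = 0"
      using LN[OF y] 0 by (simp add: clinear_diff[OF L(1)] Lj)
    then have "y = 0"
      using inv(1)[of y] clinear_zero[OF clinear_conv_act[OF D hlin]] by simp
    with y show "x \<in> ?N" by (simp add: clinear_zero[OF tj])
  qed (rule LN)
  have rel: "balanced_rel ?B = {(x, y). ?L x = ?L y}"
    by (simp only: balanced_rel_def ker clinear_diff[OF L(1)] right_minus_eq)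
  \<comment> \<open>The cosets are the fibres of the lift, so the image of a coset is a singleton
    and \<open>the_elem\<close> picks the common value.\<close>
  have cl: "canonical_map \<delta> (balanced_rel ?B `` {x}) = ?L x" for x
  proof -
    have "?L ` (balanced_rel ?B `` {x}) = {?L x}" by (auto simp: rel)
    then show ?thesis by (simp add: canonical_map_def)
  qed
  have "bij_betw (canonical_map \<delta>) (balanced_tensor ?B) UNIV"
    unfolding bij_betw_def
  proof (intro conjI)
    show "inj_on (canonical_map \<delta>) (balanced_tensor ?B)"
    proof (rule inj_onI)
      fix X Y assume "X \<in> balanced_tensor ?B" "Y \<in> balanced_tensor ?B"
        and eq: "canonical_map \<delta> X = canonical_map \<delta> Y"
      then obtain x y where XY: "X = balanced_rel ?B `` {x}" "Y = balanced_rel ?B `` {y}"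
        by (auto simp: balanced_tensor_def elim!: quotientE)
      with eq have "?L x = ?L y" by (simp add: cl)
      with XY show "X = Y" by (simp add: rel)
    qed
    have "z \<in> canonical_map \<delta> ` balanced_tensor ?B" for z
    proof
      \<comment> \<open>The preimage of a \<otimes> x is the class of a h(x_1) \<otimes>
        j(x_2).\<close>
      show "z = canonical_map \<delta> (balanced_rel ?B `` {tmap id j (conv_act \<Delta> h z)})"
        by (simp add: cl Lj inv)
    qed (simp add: balanced_tensor_def quotientI)
    then show "canonical_map \<delta> ` balanced_tensor ?B = UNIV" by blast
  qed
  with hopf comod show ?thesis by (simp add: hopf_galois_def)
qed

section \<open>The Hopf superalgebra of the general linear group\<close>

text \<open>Scalars written as multiples of 1 turn the counit axioms into statements about products
  of two morphisms, within reach of \<open>tlift_hom\<close>.\<close>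

lemma unit_hom:
  "superalgebra_hom \<epsilon> \<Longrightarrow> superalgebra_hom (\<lambda>x. \<epsilon> x *\<^sub>C (1::'a::superalgebra))"
proof (rule superalgebra_homI)
  fix i x assume e: "superalgebra_hom \<epsilon>"
  have "spart i (1::'a) = (if i = 0 then 1 else 0)"
    using spart_one spart_other[OF spart_one] by auto
  then show "\<epsilon> (spart i x) *\<^sub>C (1::'a) = spart i (\<epsilon> x *\<^sub>C 1)"
    using superalgebra_homD(10)[OF e, of i x] by (simp add: spart_scaleC)
qed (simp_all add: superalgebra_homD clinear_iff scaleC_add_left mult.commute)

section \<open>Determinants and the structure maps on generators\<close>

lemma free_lift_det:
  "free_lift f ((fgen a * fgen b - fgen c * fgen d) * fgen t - 1) = (f a * f b - f c * f d) * f t - 1"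
  by (simp only: clinear_diff[OF clinear_free_lift] free_lift_mult free_lift_fgen free_lift_one)

text \<open>The 2 x 2 determinant is multiplicative once all entries commute, which evenness
  ensures. With X in the left and Y in the right tensor factor, this yields the determinant relation
  for both the comultiplication and the coaction.\<close>

lemma det_mult:
  fixes x11 :: "'a::supercommutative"
  assumes [simp]: "spart 0 x11 = x11" "spart 0 x12 = x12" "spart 0 x21 = x21" "spart 0 x22 = x22"
    "spart 0 y11 = y11" "spart 0 y12 = y12" "spart 0 y21 = y21" "spart 0 y22 = y22"
    "spart 0 s = s" "spart 0 t = t"
    and x: "(x11 * x22 - x12 * x21) * s = 1" and y: "(y11 * y22 - y12 * y21) * t = 1"
  shows "((x11 * y11 + x12 * y21) * (x21 * y12 + x22 * y22)
    - (x11 * y12 + x12 * y22) * (x21 * y11 + x22 * y21)) * (s * t) = 1"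
proof -
  have "((x11 * y11 + x12 * y21) * (x21 * y12 + x22 * y22)
      - (x11 * y12 + x12 * y22) * (x21 * y11 + x22 * y21)) * (s * t)
    = ((x11 * x22 - x12 * x21) * s) * ((y11 * y22 - y12 * y21) * t)"
    by (simp add: distrib_left distrib_right left_diff_distrib right_diff_distrib mult.assoc
        even_commute even_left_commute)
  then show ?thesis by (simp add: x y)
qed

lemma GL_even: "spart 0 x = (x::C_GL2)"
  by (induction x rule: pres_alg_induct)
    (simp_all add: spart_one spart_gen_mult spart_add spart_scaleC gpar_GL_gen_def)

lemma GL_tensor_even: "spart 0 x = (x::(C_GL2, C_GL2) tensor)"
  by (induction x rule: tensor_induct) (simp_all add: spart_hom[OF GL_even GL_even] spart_add)

lemmas GL_commute = even_commute[OF GL_even] even_left_commute[OF GL_even]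

lemma GL_det:
  "(pgen (GL_g 1 1) * pgen (GL_g 2 2) - pgen (GL_g 1 2) * pgen (GL_g 2 1)) * pgen GL_T = 1"
proof -
  have "abs_pres_alg ((fgen (GL_g 1 1) * fgen (GL_g 2 2) - fgen (GL_g 1 2) * fgen (GL_g 2 1))
      * fgen GL_T - 1) = 0"
    by (rule super_relation_zero) (simp add: super_relations_def grel_GL_gen_def)
  then show ?thesis
    by (simp add: pgen_def flip: times_pres_alg.abs_eq minus_pres_alg.abs_eq one_pres_alg.abs_eq)
qed

lemma GL_respects:
  fixes f :: "GL_gen \<Rightarrow> 'b::supercommutative"
  assumes "\<And>x. spart 0 (f x) = f x"
    "(f (GL_g 1 1) * f (GL_g 2 2) - f (GL_g 1 2) * f (GL_g 2 1)) * f GL_T = 1"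
  shows "respects_relations f"
  by (rule respects_relationsI) (use assms in \<open>auto simp: gpar_GL_gen_def grel_GL_gen_def free_lift_det\<close>)

lemma one_neq_two [simp]: "(1::2) \<noteq> 2" "(2::2) \<noteq> 1"
  by simp_all

lemma two_plus_one [simp]: "(2::2) + 1 = 1" "(1::2) + 1 = 2" "(3::2) = 1"
  by simp_all

lemma tens_factor: "a \<otimes> h = (a \<otimes> 1) * (1 \<otimes> h)"
  by (simp add: tens_mult_left)

lemma inl_even: "spart 0 a = a \<Longrightarrow> spart 0 (a \<otimes> 1) = a \<otimes> 1"
  using superalgebra_homD(10)[OF inl_hom, of 0 a, symmetric] by simp

lemma inr_even: "spart 0 h = h \<Longrightarrow> spart 0 (1 \<otimes> h) = 1 \<otimes> h"
  using superalgebra_homD(10)[OF inr_hom, of 0 h, symmetric] by simp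

lemma GL2_comult_respects: "respects_relations (\<lambda>x. case x of
      GL_g i j \<Rightarrow> \<Sum>m\<in>UNIV. pgen (GL_g i m) \<otimes> pgen (GL_g m j)
    | GL_T \<Rightarrow> pgen GL_T \<otimes> pgen GL_T)"
proof (rule GL_respects[OF GL_tensor_even], simp only: GL_gen.case sum_2)
  note hom = superalgebra_homD[OF inl_hom] superalgebra_homD[OF inr_hom]
  let ?l = "\<lambda>x. pgen x \<otimes> 1 :: (C_GL2, C_GL2) tensor" and ?r = "\<lambda>x. 1 \<otimes> pgen x :: (C_GL2, C_GL2) tensor"
  have "(?l (GL_g 1 1) * ?l (GL_g 2 2) - ?l (GL_g 1 2) * ?l (GL_g 2 1)) * ?l GL_T = 1"
    "(?r (GL_g 1 1) * ?r (GL_g 2 2) - ?r (GL_g 1 2) * ?r (GL_g 2 1)) * ?r GL_T = 1"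
    by (simp_all only: hom(9)[symmetric] hom(19)[symmetric] hom(6)[symmetric] hom(16)[symmetric]
        GL_det one_tensor_def)
  from det_mult[OF _ _ _ _ _ _ _ _ _ _ this] show "((pgen (GL_g 1 1) \<otimes> pgen (GL_g 1 1) + pgen (GL_g 1 2) \<otimes> pgen (GL_g 2 1)) *
      (pgen (GL_g 2 1) \<otimes> pgen (GL_g 1 2) + pgen (GL_g 2 2) \<otimes> pgen (GL_g 2 2)) -
      (pgen (GL_g 1 1) \<otimes> pgen (GL_g 1 2) + pgen (GL_g 1 2) \<otimes> pgen (GL_g 2 2)) *
      (pgen (GL_g 2 1) \<otimes> pgen (GL_g 1 1) + pgen (GL_g 2 2) \<otimes> pgen (GL_g 2 1))) *
      (pgen GL_T \<otimes> pgen GL_T) = (1 :: (C_GL2, C_GL2) tensor)"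
    by (simp add: GL_tensor_even flip: tens_factor)
qed

lemma GL2_comult_hom: "superalgebra_hom GL2_comult"
  unfolding GL2_comult_def by (rule pres_lift_hom[OF GL2_comult_respects])

lemma GL2_comult_gen:
  "GL2_comult (pgen (GL_g i j)) = (\<Sum>m\<in>UNIV. pgen (GL_g i m) \<otimes> pgen (GL_g m j))"
  "GL2_comult (pgen GL_T) = pgen GL_T \<otimes> pgen GL_T"
  unfolding GL2_comult_def by (simp_all only: pres_lift_gen[OF GL2_comult_respects] GL_gen.case)

lemma GL2_counit_respects:
  "respects_relations (\<lambda>x. case x of GL_g i j \<Rightarrow> if i = j then 1 else 0 | GL_T \<Rightarrow> (1 :: complex))"
  by (rule GL_respects) simp_all

lemma GL2_counit_hom: "superalgebra_hom GL2_counit"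
  unfolding GL2_counit_def by (rule pres_lift_hom[OF GL2_counit_respects])

lemma GL2_counit_gen:
  "GL2_counit (pgen (GL_g i j)) = (if i = j then 1 else 0)" "GL2_counit (pgen GL_T) = 1"
  unfolding GL2_counit_def by (simp_all only: pres_lift_gen[OF GL2_counit_respects] GL_gen.case)

lemma GL2_antipode_respects: "respects_relations (\<lambda>x. case x of
      GL_g i j \<Rightarrow> if i = j then pgen (GL_g (i + 1) (i + 1)) * pgen GL_T
                 else - (pgen (GL_g i j) * pgen GL_T)
    | GL_T \<Rightarrow> pgen (GL_g 1 1) * pgen (GL_g 2 2) - pgen (GL_g 1 2) * pgen (GL_g 2 1))"
proof (rule GL_respects[OF GL_even], simp only: GL_gen.case one_neq_two two_plus_one if_True if_False simp_thms)
  let ?g = "\<lambda>i j. pgen (GL_g i j)" and ?d = "pgen (GL_g 1 1) * pgen (GL_g 2 2) - pgen (GL_g 1 2) * pgen (GL_g 2 1)"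
    and ?t = "pgen GL_T"
  \<comment> \<open>The adjugate also has determinant d, so the adjugate times t has determinant d
    t^2; the image of \<open>GL_T\<close> contributes another d.\<close>
  have "(?g 2 2 * ?t * (?g 1 1 * ?t) - - (?g 1 2 * ?t) * - (?g 2 1 * ?t)) * ?d
      = (?d * ?t) * (?d * ?t)"
    by (simp add: algebra_simps GL_commute)
  then show "(?g 2 2 * ?t * (?g 1 1 * ?t) - - (?g 1 2 * ?t) * - (?g 2 1 * ?t)) * ?d = 1"
    by (simp only: GL_det mult_1_left)
qed

lemma GL2_antipode_hom: "superalgebra_hom GL2_antipode"
  unfolding GL2_antipode_def by (rule pres_lift_hom[OF GL2_antipode_respects])

lemma GL2_antipode_gen:
  "GL2_antipode (pgen (GL_g i j)) = (if i = j then pgen (GL_g (i + 1) (i + 1)) * pgen GL_T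
    else - (pgen (GL_g i j) * pgen GL_T))"
  "GL2_antipode (pgen GL_T) = pgen (GL_g 1 1) * pgen (GL_g 2 2) - pgen (GL_g 1 2) * pgen (GL_g 2 1)"
  unfolding GL2_antipode_def by (simp_all only: pres_lift_gen[OF GL2_antipode_respects] GL_gen.case)

lemma GL_inverse:
  "(\<Sum>m\<in>UNIV. GL2_antipode (pgen (GL_g i m)) * pgen (GL_g m j)) = (if i = j then 1 else 0)"
  "(\<Sum>m\<in>UNIV. pgen (GL_g i m) * GL2_antipode (pgen (GL_g m j))) = (if i = j then 1 else 0)"
proof -
  \<comment> \<open>The determinant relation solved for one monomial, to serve as a rewrite rule in
    the diagonal entries of the adjugate identity.\<close>
  have "pgen (GL_g 1 1) * (pgen (GL_g 2 2) * pgen GL_T)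
      = 1 + pgen (GL_g 1 2) * (pgen (GL_g 2 1) * pgen GL_T)"
    using GL_det by (simp add: algebra_simps)
  then show "(\<Sum>m\<in>UNIV. GL2_antipode (pgen (GL_g i m)) * pgen (GL_g m j)) = (if i = j then 1 else 0)"
    "(\<Sum>m\<in>UNIV. pgen (GL_g i m) * GL2_antipode (pgen (GL_g m j))) = (if i = j then 1 else 0)"
    using exhaust_2[of i] exhaust_2[of j]
    by (auto simp: sum_2 GL2_antipode_gen GL_commute mult.assoc)
qed

section \<open>The Hopf axioms checked on generators\<close>

lemma tlift_gens:
  assumes "superalgebra_hom f" "superalgebra_hom g"
  shows "tlift (\<lambda>a b. f a * g b :: 'c::supercommutative) (a \<otimes> b) = f a * g b"
    "tlift (\<lambda>a b. f a * g b) (x + y) = tlift (\<lambda>a b. f a * g b) x + tlift (\<lambda>a b. f a * g b) y"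
    "tlift (\<lambda>a b. f a * g b) (sum F S) = (\<Sum>m\<in>S. tlift (\<lambda>a b. f a * g b) (F m))"
  using assms
  by (simp_all add: cbilinear_mult superalgebra_homD superalgebra_homD(3)[OF tlift_hom]
      clinear_sum superalgebra_homD(1)[OF tlift_hom])

text \<open>Formulated for a coaction so that it covers \<open>GL2_comult\<close>, coacting on its
  own algebra, as well as \<open>S_coaction\<close>.\<close>

lemma coassoc_gens:
  fixes \<delta> :: "'g::presentation pres_alg \<Rightarrow> ('g pres_alg, 'h::supercommutative) tensor"
  assumes "superalgebra_hom \<delta>" "superalgebra_hom \<Delta>"
    and "\<And>g. tassoc (tmap \<delta> id (\<delta> (pgen g))) = tmap id \<Delta> (\<delta> (pgen g))"
  shows "tassoc (tmap \<delta> id (\<delta> x)) = tmap id \<Delta> (\<delta> x)"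
  by (rule hom_pres_alg_eqI[of "\<lambda>x. tassoc (tmap \<delta> id (\<delta> x))" "\<lambda>x. tmap id \<Delta> (\<delta> x)"])
    (intro superalgebra_hom_comp[OF tassoc_hom] superalgebra_hom_comp[OF tmap_hom]
      superalgebra_hom_id assms)+

text \<open>Each axiom compares two morphisms. The antipode axioms fit this pattern because
  \<open>GL2_antipode\<close> is itself a morphism and the target is supercommutative, so that x_1
  S(x_2) and S(x_1) x_2 depend multiplicatively on x.\<close>

lemma GL2_hopf: "hopf_superalgebra GL2_comult GL2_counit GL2_antipode"
proof -
  note hom = GL2_comult_hom GL2_counit_hom GL2_antipode_hom
  note [simp] = superalgebra_homD(1)[OF GL2_comult_hom] clinear_add[OF clinear_tassoc]
  have coassoc: "tassoc (tmap GL2_comult id (GL2_comult x)) = tmap id GL2_comult (GL2_comult x)" for x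
  proof (rule coassoc_gens[OF hom(1) hom(1)])
    show "tassoc (tmap GL2_comult id (GL2_comult (pgen g))) = tmap id GL2_comult (GL2_comult (pgen g))" for g
      by (cases g) (simp_all add: GL2_comult_gen sum_2 tens_simps)
  qed
  have "tlift (\<lambda>a b. (GL2_counit a *\<^sub>C 1) * b) (GL2_comult x) = x" for x
  proof (rule hom_pres_alg_eqI[of _ "\<lambda>x. x"])
    fix g
    show "tlift (\<lambda>a b. (GL2_counit a *\<^sub>C 1) * b) (GL2_comult (pgen g)) = pgen g"
      using exhaust_2 by (cases g)
        (auto simp: GL2_comult_gen sum_2 GL2_counit_gen
          tlift_gens[OF unit_hom[OF hom(2)] superalgebra_hom_id(2)] simp del: mult_scaleC_left)
  qed (intro superalgebra_hom_comp[OF tlift_hom] unit_hom superalgebra_hom_id hom)+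
  moreover have "tlift (\<lambda>a b. a * (GL2_counit b *\<^sub>C 1)) (GL2_comult x) = x" for x
  proof (rule hom_pres_alg_eqI[of _ "\<lambda>x. x"])
    fix g
    show "tlift (\<lambda>a b. a * (GL2_counit b *\<^sub>C 1)) (GL2_comult (pgen g)) = pgen g"
      using exhaust_2 by (cases g)
        (auto simp: GL2_comult_gen sum_2 GL2_counit_gen
          tlift_gens[OF superalgebra_hom_id(2) unit_hom[OF hom(2)]] simp del: mult_scaleC_right)
  qed (intro superalgebra_hom_comp[OF tlift_hom] unit_hom superalgebra_hom_id hom)+
  moreover have "tlift (\<lambda>a b. GL2_antipode a * b) (GL2_comult x) = GL2_counit x *\<^sub>C 1" for x
  proof (rule hom_pres_alg_eqI[of _ "\<lambda>x. GL2_counit x *\<^sub>C 1"])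
    fix g
    show "tlift (\<lambda>a b. GL2_antipode a * b) (GL2_comult (pgen g)) = GL2_counit (pgen g) *\<^sub>C 1"
      by (cases g)
        (simp_all add: GL2_comult_gen GL2_counit_gen GL_inverse GL2_antipode_gen(2) GL_det
          tlift_gens[OF hom(3) superalgebra_hom_id(2)])
  qed (intro superalgebra_hom_comp[OF tlift_hom] unit_hom superalgebra_hom_id hom)+
  moreover have "tlift (\<lambda>a b. a * GL2_antipode b) (GL2_comult x) = GL2_counit x *\<^sub>C 1" for x
  proof (rule hom_pres_alg_eqI[of _ "\<lambda>x. GL2_counit x *\<^sub>C 1"])
    fix g
    show "tlift (\<lambda>a b. a * GL2_antipode b) (GL2_comult (pgen g)) = GL2_counit (pgen g) *\<^sub>C 1"
      using GL_det by (cases g)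
        (simp_all add: GL2_comult_gen GL2_counit_gen GL_inverse GL2_antipode_gen(2)
          tlift_gens[OF superalgebra_hom_id(2) hom(3)] GL_commute(1)[of "pgen GL_T"])
  qed (intro superalgebra_hom_comp[OF tlift_hom] unit_hom superalgebra_hom_id hom)+
  ultimately show ?thesis
    using hom coassoc by (simp add: hopf_superalgebra_def superalgebra_homD)
qed

section \<open>The coaction and the cleaving map\<close>

lemma S_even: "spart 0 (pgen (S_a i j)) = pgen (S_a i j)" "spart 0 (pgen S_T) = pgen S_T"
  using pgen_parity[of "S_a i j"] pgen_parity[of S_T] by (simp_all add: gpar_S_gen_def)

lemma S_det:
  "(pgen (S_a 1 1) * pgen (S_a 2 2) - pgen (S_a 1 2) * pgen (S_a 2 1)) * pgen S_T = 1"
proof -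
  have "abs_pres_alg ((fgen (S_a 1 1) * fgen (S_a 2 2) - fgen (S_a 1 2) * fgen (S_a 2 1))
      * fgen S_T - 1) = 0"
    by (rule super_relation_zero) (simp add: super_relations_def grel_S_gen_def)
  then show ?thesis
    by (simp add: pgen_def flip: times_pres_alg.abs_eq minus_pres_alg.abs_eq one_pres_alg.abs_eq)
qed

lemma S_respects:
  fixes f :: "S_gen \<Rightarrow> 'b::supercommutative"
  assumes "\<And>i j. spart 0 (f (S_a i j)) = f (S_a i j)" "\<And>k l. spart 1 (f (S_alpha k l)) = f (S_alpha k l)"
    "spart 0 (f S_T) = f S_T"
    "(f (S_a 1 1) * f (S_a 2 2) - f (S_a 1 2) * f (S_a 2 1)) * f S_T = 1"
  shows "respects_relations f"
proof (rule respects_relationsI)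
  show "spart (gpar x) (f x) = f x" for x
    by (cases x) (simp_all add: assms gpar_S_gen_def)
qed (use assms in \<open>auto simp: grel_S_gen_def free_lift_det\<close>)

lemma M_respects:
  fixes f :: "M_gen \<Rightarrow> 'b::supercommutative"
  assumes "\<And>i j. spart 0 (f (M_u i j)) = f (M_u i j)" "\<And>k l. spart 1 (f (M_nu k l)) = f (M_nu k l)"
  shows "respects_relations f"
proof (rule respects_relationsI)
  show "spart (gpar x) (f x) = f x" for x
    by (cases x) (simp_all add: assms gpar_M_gen_def)
qed (simp add: grel_M_gen_def)

text \<open>The upper block becomes a product of two generic matrices, so \<open>det_mult\<close>
  gives the determinant relation; odd rows stay odd because the coordinates of GL_2 are
  even.\<close>

lemma S_coaction_respects: "respects_relations (\<lambda>x. case x of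
      S_a i j \<Rightarrow> \<Sum>m\<in>UNIV. pgen (S_a i m) \<otimes> pgen (GL_g m j)
    | S_alpha k l \<Rightarrow> \<Sum>m\<in>UNIV. pgen (S_alpha k m) \<otimes> pgen (GL_g m l)
    | S_T \<Rightarrow> pgen S_T \<otimes> pgen GL_T)"
proof (rule S_respects; simp only: S_gen.case sum_2)
  have odd: "spart 1 (pgen (S_alpha k l)) = pgen (S_alpha k l)" for k l
    using pgen_parity[of "S_alpha k l"] by (simp add: gpar_S_gen_def)
  show "spart 0 (pgen (S_a i 1) \<otimes> pgen (GL_g 1 j) + pgen (S_a i 2) \<otimes> pgen (GL_g 2 j))
      = pgen (S_a i 1) \<otimes> pgen (GL_g 1 j) + pgen (S_a i 2) \<otimes> pgen (GL_g 2 j)" for i j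
    by (simp add: spart_add spart_hom[OF S_even(1) GL_even])
  show "spart 1 (pgen (S_alpha k 1) \<otimes> pgen (GL_g 1 l) + pgen (S_alpha k 2) \<otimes> pgen (GL_g 2 l))
      = pgen (S_alpha k 1) \<otimes> pgen (GL_g 1 l) + pgen (S_alpha k 2) \<otimes> pgen (GL_g 2 l)" for k l
    by (simp add: spart_add spart_hom[OF odd GL_even])
  show "spart 0 (pgen S_T \<otimes> pgen GL_T) = pgen S_T \<otimes> pgen GL_T"
    by (simp add: spart_hom[OF S_even(2) GL_even])
  note hom = superalgebra_homD[OF inl_hom] superalgebra_homD[OF inr_hom]
  let ?l = "\<lambda>x. pgen x \<otimes> 1 :: (C_S, C_GL2) tensor" and ?r = "\<lambda>x. 1 \<otimes> pgen x :: (C_S, C_GL2) tensor"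
  have "(?l (S_a 1 1) * ?l (S_a 2 2) - ?l (S_a 1 2) * ?l (S_a 2 1)) * ?l S_T = 1"
    "(?r (GL_g 1 1) * ?r (GL_g 2 2) - ?r (GL_g 1 2) * ?r (GL_g 2 1)) * ?r GL_T = 1"
    by (simp_all only: hom(9)[symmetric] hom(19)[symmetric] hom(6)[symmetric] hom(16)[symmetric]
        GL_det S_det one_tensor_def)
  from det_mult[OF _ _ _ _ _ _ _ _ _ _ this]
  show "((pgen (S_a 1 1) \<otimes> pgen (GL_g 1 1) + pgen (S_a 1 2) \<otimes> pgen (GL_g 2 1)) *
      (pgen (S_a 2 1) \<otimes> pgen (GL_g 1 2) + pgen (S_a 2 2) \<otimes> pgen (GL_g 2 2)) -
      (pgen (S_a 1 1) \<otimes> pgen (GL_g 1 2) + pgen (S_a 1 2) \<otimes> pgen (GL_g 2 2)) *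
      (pgen (S_a 2 1) \<otimes> pgen (GL_g 1 1) + pgen (S_a 2 2) \<otimes> pgen (GL_g 2 1))) *
      (pgen S_T \<otimes> pgen GL_T) = (1 :: (C_S, C_GL2) tensor)"
    by (simp add: inl_even inr_even S_even GL_even flip: tens_factor)
qed

lemma S_coaction_hom: "superalgebra_hom S_coaction"
  unfolding S_coaction_def by (rule pres_lift_hom[OF S_coaction_respects])

lemma S_coaction_gen:
  "S_coaction (pgen (S_a i j)) = (\<Sum>m\<in>UNIV. pgen (S_a i m) \<otimes> pgen (GL_g m j))"
  "S_coaction (pgen (S_alpha k l)) = (\<Sum>m\<in>UNIV. pgen (S_alpha k m) \<otimes> pgen (GL_g m l))"
  "S_coaction (pgen S_T) = pgen S_T \<otimes> pgen GL_T"
  unfolding S_coaction_def by (simp_all only: pres_lift_gen[OF S_coaction_respects] S_gen.case)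

lemma S_comodule: "comodule_superalgebra GL2_comult GL2_counit S_coaction"
proof -
  note [simp] = superalgebra_homD(1)[OF GL2_comult_hom] superalgebra_homD(1)[OF S_coaction_hom]
    clinear_add[OF clinear_tassoc]
  have "tassoc (tmap S_coaction id (S_coaction x)) = tmap id GL2_comult (S_coaction x)" for x
  proof (rule coassoc_gens[OF S_coaction_hom GL2_comult_hom])
    show "tassoc (tmap S_coaction id (S_coaction (pgen g))) = tmap id GL2_comult (S_coaction (pgen g))" for g
      by (cases g) (simp_all add: S_coaction_gen GL2_comult_gen sum_2 tens_simps)
  qed
  moreover have "tlift (\<lambda>b h. b * (GL2_counit h *\<^sub>C 1)) (S_coaction x) = x" for x
  proof (rule hom_pres_alg_eqI[of _ "\<lambda>x. x"])
    fix g
    show "tlift (\<lambda>b h. b * (GL2_counit h *\<^sub>C 1)) (S_coaction (pgen g)) = pgen g"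
      using exhaust_2 by (cases g)
        (auto simp: S_coaction_gen sum_2 GL2_counit_gen
          tlift_gens[OF superalgebra_hom_id(2) unit_hom[OF GL2_counit_hom]] simp del: mult_scaleC_right)
  qed (intro superalgebra_hom_comp[OF tlift_hom] unit_hom superalgebra_hom_id GL2_counit_hom S_coaction_hom)+
  ultimately show ?thesis
    using S_coaction_hom by (simp add: comodule_superalgebra_def)
qed

text \<open>The row embeddings are given by cases, since type \<open>2\<close> is cyclic: its
  numeral 2 is 0.\<close>

definition upper_row :: "2 \<Rightarrow> 4" where "upper_row i = (if i = 1 then 1 else 2)"
definition lower_row :: "2 \<Rightarrow> 4" where "lower_row i = (if i = 1 then 3 else 4)"

definition S_cleaving :: "C_GL2 \<Rightarrow> C_S"
  where "S_cleaving = pres_lift (\<lambda>x. case x of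
      GL_g i j \<Rightarrow> pgen (S_a (upper_row i) j)
    | GL_T \<Rightarrow> pgen S_T)"

lemma S_cleaving_respects: "respects_relations (\<lambda>x. case x of
      GL_g i j \<Rightarrow> pgen (S_a (upper_row i) j) | GL_T \<Rightarrow> pgen S_T)"
proof (rule GL_respects)
  show "spart 0 (case x of GL_g i j \<Rightarrow> pgen (S_a (upper_row i) j) | GL_T \<Rightarrow> pgen S_T)
      = (case x of GL_g i j \<Rightarrow> pgen (S_a (upper_row i) j) | GL_T \<Rightarrow> pgen S_T)" for x
    by (cases x) (simp_all add: S_even)
qed (simp only: GL_gen.case upper_row_def one_neq_two if_True if_False simp_thms S_det)

lemma S_cleaving_hom: "superalgebra_hom S_cleaving"
  unfolding S_cleaving_def by (rule pres_lift_hom[OF S_cleaving_respects])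

lemma S_cleaving_gen:
  "S_cleaving (pgen (GL_g i j)) = pgen (S_a (upper_row i) j)" "S_cleaving (pgen GL_T) = pgen S_T"
  unfolding S_cleaving_def by (simp_all only: pres_lift_gen[OF S_cleaving_respects] GL_gen.case)

text \<open>Dually, taking the upper block is equivariant, since right multiplication acts on each
  row separately.\<close>

lemma S_cleaving_comodule: "S_coaction (S_cleaving x) = tmap S_cleaving id (GL2_comult x)"
proof (rule hom_pres_alg_eqI[of "\<lambda>x. S_coaction (S_cleaving x)" "\<lambda>x. tmap S_cleaving id (GL2_comult x)"])
  show "S_coaction (S_cleaving (pgen g)) = tmap S_cleaving id (GL2_comult (pgen g))" for g
    using superalgebra_homD(1)[OF S_cleaving_hom]
    by (cases g) (simp_all add: S_cleaving_gen S_coaction_gen GL2_comult_gen sum_2)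
qed (intro superalgebra_hom_comp[OF S_coaction_hom] superalgebra_hom_comp[OF tmap_hom]
    S_cleaving_hom GL2_comult_hom superalgebra_hom_id)+

text \<open>Being multiplicative, \<open>S_cleaving\<close> carries the two antipode identities of
  GL_2 to the statement that its composite with the antipode is a two-sided convolution
  inverse.\<close>

lemma S_cleaving_map: "cleaving_map GL2_comult GL2_counit S_coaction S_cleaving"
proof -
  note hom = S_cleaving_hom GL2_antipode_hom
  note lin = superalgebra_homD(1)[OF hom(1)] superalgebra_homD(1)[OF hom(2)]
  have h: "super_linear (\<lambda>x. S_cleaving (GL2_antipode x))"
    by (rule superalgebra_homD(2)[OF superalgebra_hom_comp[OF hom]])
  have S: "tlift (\<lambda>a b. a * GL2_antipode b) (GL2_comult x) = GL2_counit x *\<^sub>C 1"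
    "tlift (\<lambda>a b. GL2_antipode a * b) (GL2_comult x) = GL2_counit x *\<^sub>C 1" for x
    using GL2_hopf unfolding hopf_superalgebra_def by blast+
  have bil: "cbilinear (\<lambda>a b. a * GL2_antipode b)" "cbilinear (\<lambda>a b. GL2_antipode a * b)"
    by (intro cbilinear_mult lin superalgebra_homD(1)[OF superalgebra_hom_id(2)])+
  note j = superalgebra_homD[OF S_cleaving_hom]
  have "convolution GL2_comult S_cleaving (\<lambda>x. S_cleaving (GL2_antipode x)) x = GL2_counit x *\<^sub>C 1"
    "convolution GL2_comult (\<lambda>x. S_cleaving (GL2_antipode x)) S_cleaving x = GL2_counit x *\<^sub>C 1" for x
    using arg_cong[OF S(1)[of x], of S_cleaving] arg_cong[OF S(2)[of x], of S_cleaving]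
    by (simp_all only: tlift_comp[OF lin(1) bil(1)] tlift_comp[OF lin(1) bil(2)] j(4,8,9) convolution_def)
  then show ?thesis
    unfolding cleaving_map_def using h superalgebra_homD(2)[OF S_cleaving_hom] S_cleaving_comodule by blast
qed

section \<open>The coinvariants\<close>

text \<open>Serves the even lower rows and the odd rows alike: w is the row b times the inverse of
  the upper block. Coinvariance follows without computing the coaction on w, because \<delta>(w) and
  w \<otimes> 1 solve the same linear system with an invertible matrix.\<close>

lemma coinvariant_row:
  fixes b :: "2 \<Rightarrow> C_S"
  assumes b: "\<And>l. S_coaction (b l) = (\<Sum>m\<in>UNIV. b m \<otimes> pgen (GL_g m l))"
  defines "w \<equiv> \<lambda>r. \<Sum>m\<in>UNIV. b m * S_cleaving (GL2_antipode (pgen (GL_g m r)))"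
  shows "(\<Sum>r\<in>UNIV. w r * S_cleaving (pgen (GL_g r l))) = b l"
    and "S_coaction (w r) = w r \<otimes> 1"
proof -
  let ?j = S_cleaving and ?S = GL2_antipode and ?g = "\<lambda>i j. pgen (GL_g i j)" and ?d = S_coaction
  note j = superalgebra_homD[OF S_cleaving_hom] and d = superalgebra_homD[OF S_coaction_hom]
  have inv: "?j (?S (?g i 1)) * ?j (?g 1 l) + ?j (?S (?g i 2)) * ?j (?g 2 l) = (if i = l then 1 else 0)"
    "?j (?g i 1) * ?j (?S (?g 1 l)) + ?j (?g i 2) * ?j (?S (?g 2 l)) = (if i = l then 1 else 0)" for i l
    using arg_cong[OF GL_inverse(1)[of i l], of ?j] arg_cong[OF GL_inverse(2)[of i l], of ?j]
    by (simp_all add: sum_2 j split: if_splits)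
  have rec: "(\<Sum>r\<in>UNIV. w r * ?j (?g r l)) = b l" for l
  proof -
    have "(\<Sum>r\<in>UNIV. w r * ?j (?g r l))
      = b 1 * (?j (?S (?g 1 1)) * ?j (?g 1 l) + ?j (?S (?g 1 2)) * ?j (?g 2 l))
      + b 2 * (?j (?S (?g 2 1)) * ?j (?g 1 l) + ?j (?S (?g 2 2)) * ?j (?g 2 l))"
      by (simp add: w_def sum_2 distrib_left distrib_right mult.assoc add_ac)
    then show ?thesis using exhaust_2[of l] by (auto simp: inv)
  qed
  then show "(\<Sum>r\<in>UNIV. w r * ?j (?g r l)) = b l" .
  let ?c = "\<lambda>r. ?d (w r) - w r \<otimes> 1"
  have lin: "clinear ?j" by (rule j)
  have "?d (w 1) * ?d (?j (?g 1 l)) + ?d (w 2) * ?d (?j (?g 2 l)) = ?d (b l)" for l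
    using arg_cong[OF rec[of l], of ?d] by (simp add: sum_2 d)
  \<comment> \<open>Expanding each \<open>b m\<close> by \<open>rec\<close> exhibits
    \<open>?d (b l)\<close> as an entry of the row w \<otimes> 1 times the matrix
    \<delta>(j(g)).\<close>
  moreover have rhs: "?d (b l) = (\<Sum>m\<in>UNIV. (\<Sum>r\<in>UNIV. w r * ?j (?g r m)) \<otimes> ?g m l)" for l
    by (simp only: b rec)
  moreover have "(w 1 \<otimes> 1) * ?d (?j (?g 1 l)) + (w 2 \<otimes> 1) * ?d (?j (?g 2 l)) = ?d (b l)" for l
    unfolding rhs
    by (simp add: S_cleaving_comodule GL2_comult_gen sum_2 lin distrib_left tens_mult_left tens_simps add_ac)
  ultimately have 0: "?c 1 * ?d (?j (?g 1 l)) + ?c 2 * ?d (?j (?g 2 l)) = 0" for l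
    by (simp add: left_diff_distrib algebra_simps)
  have X: "?d (?j (?g k 1)) * ?d (?j (?S (?g 1 r))) + ?d (?j (?g k 2)) * ?d (?j (?S (?g 2 r)))
      = (if k = r then 1 else 0)" for k
    using arg_cong[OF inv(2)[of k r], of ?d] by (simp add: d split: if_splits)
  \<comment> \<open>The system is cancelled by multiplying on the right with \<delta>(j(S(g))),
    which by \<open>X\<close> is a right inverse of the coefficient matrix.\<close>
  have "0 = (?c 1 * ?d (?j (?g 1 1)) + ?c 2 * ?d (?j (?g 2 1))) * ?d (?j (?S (?g 1 r)))
      + (?c 1 * ?d (?j (?g 1 2)) + ?c 2 * ?d (?j (?g 2 2))) * ?d (?j (?S (?g 2 r)))"
    by (simp only: 0 mult_zero_left add_0_left)
  also have "\<dots> = ?c 1 * (?d (?j (?g 1 1)) * ?d (?j (?S (?g 1 r))) + ?d (?j (?g 1 2)) * ?d (?j (?S (?g 2 r))))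
      + ?c 2 * (?d (?j (?g 2 1)) * ?d (?j (?S (?g 1 r))) + ?d (?j (?g 2 2)) * ?d (?j (?S (?g 2 r))))"
    by (simp only: distrib_left distrib_right mult.assoc add_ac)
  also have "\<dots> = ?c r"
    unfolding X using exhaust_2[of r] by auto
  finally show "?d (w r) = w r \<otimes> 1" by simp
qed

text \<open>The matrix \<open>(u; \<nu>)\<close> of affine coordinates is the product of the lower rows of the
  generic matrix of \<open>S\<close> with the inverse of the upper \<open>2 \<times> 2\<close> block.\<close>

definition M_embed :: "C_M \<Rightarrow> C_S"
  where "M_embed = pres_lift (\<lambda>x. case x of
      M_u i j \<Rightarrow> \<Sum>m\<in>UNIV. pgen (S_a (lower_row i) m) * S_cleaving (GL2_antipode (pgen (GL_g m j)))
    | M_nu k l \<Rightarrow> \<Sum>m\<in>UNIV. pgen (S_alpha k m) * S_cleaving (GL2_antipode (pgen (GL_g m l))))"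

lemma S_cleaving_even: "spart 0 (S_cleaving x) = S_cleaving x"
  using superalgebra_homD(10)[OF S_cleaving_hom, of 0 x] by (simp add: GL_even)

lemma M_embed_respects: "respects_relations (\<lambda>x. case x of
      M_u i j \<Rightarrow> \<Sum>m\<in>UNIV. pgen (S_a (lower_row i) m) * S_cleaving (GL2_antipode (pgen (GL_g m j)))
    | M_nu k l \<Rightarrow> \<Sum>m\<in>UNIV. pgen (S_alpha k m) * S_cleaving (GL2_antipode (pgen (GL_g m l))))"
proof (rule M_respects)
  have "spart 1 (pgen (S_alpha k m) * S_cleaving y) = pgen (S_alpha k m) * S_cleaving y" for k m y
    using spart_mult_hom[OF pgen_parity[of "S_alpha k m"] S_cleaving_even[of y]]
    by (simp add: gpar_S_gen_def)
  note * = this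
  show "spart 1 (case M_nu k l of
      M_u i j \<Rightarrow> \<Sum>m\<in>UNIV. pgen (S_a (lower_row i) m) * S_cleaving (GL2_antipode (pgen (GL_g m j)))
    | M_nu k l \<Rightarrow> \<Sum>m\<in>UNIV. pgen (S_alpha k m) * S_cleaving (GL2_antipode (pgen (GL_g m l))))
    = (case M_nu k l of
      M_u i j \<Rightarrow> \<Sum>m\<in>UNIV. pgen (S_a (lower_row i) m) * S_cleaving (GL2_antipode (pgen (GL_g m j)))
    | M_nu k l \<Rightarrow> \<Sum>m\<in>UNIV. pgen (S_alpha k m) * S_cleaving (GL2_antipode (pgen (GL_g m l))))" for k l
    by (simp add: spart_sum *)
qed (simp add: spart_sum even_mult S_even S_cleaving_even)

lemma M_embed_hom: "superalgebra_hom M_embed"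
  unfolding M_embed_def by (rule pres_lift_hom[OF M_embed_respects])

lemma M_embed_gen:
  "M_embed (pgen (M_u i j))
    = (\<Sum>m\<in>UNIV. pgen (S_a (lower_row i) m) * S_cleaving (GL2_antipode (pgen (GL_g m j))))"
  "M_embed (pgen (M_nu k l))
    = (\<Sum>m\<in>UNIV. pgen (S_alpha k m) * S_cleaving (GL2_antipode (pgen (GL_g m l))))"
  unfolding M_embed_def by (simp_all only: pres_lift_gen[OF M_embed_respects] M_gen.case)

text \<open>Restriction to the section of \<open>p\<close> on which the upper block is the identity matrix.\<close>

definition S_restrict :: "C_S \<Rightarrow> C_M"
  where "S_restrict = pres_lift (\<lambda>x. case x of
      S_a i j \<Rightarrow> if i = 1 then (if j = 1 then 1 else 0) else if i = 2 then (if j = 2 then 1 else 0)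
        else if i = 3 then pgen (M_u 1 j) else pgen (M_u 2 j)
    | S_alpha k l \<Rightarrow> pgen (M_nu k l)
    | S_T \<Rightarrow> 1)"

lemma distinct_4 [simp]:
  "(1::4) \<noteq> 2" "(1::4) \<noteq> 3" "(1::4) \<noteq> 4" "(2::4) \<noteq> 1" "(2::4) \<noteq> 3" "(2::4) \<noteq> 4"
  "(3::4) \<noteq> 1" "(3::4) \<noteq> 2" "(3::4) \<noteq> 4" "(4::4) \<noteq> 1" "(4::4) \<noteq> 2" "(4::4) \<noteq> 3"
  by simp_all

lemma S_restrict_respects: "respects_relations (\<lambda>x. case x of
      S_a i j \<Rightarrow> if i = 1 then (if j = 1 then 1 else 0) else if i = 2 then (if j = 2 then 1 else 0)
        else if i = 3 then pgen (M_u 1 j) else pgen (M_u 2 j)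
    | S_alpha k l \<Rightarrow> pgen (M_nu k l)
    | S_T \<Rightarrow> 1)"
proof (rule S_respects; simp only: S_gen.case distinct_4 one_neq_two if_True if_False simp_thms)
  have "spart 0 (pgen (M_u i j)) = pgen (M_u i j)" for i j
    using pgen_parity[of "M_u i j"] by (simp add: gpar_M_gen_def)
  then show "spart 0 (if i = 1 then (if j = 1 then 1 else 0) else if i = 2 then (if j = 2 then 1 else 0)
        else if i = 3 then pgen (M_u 1 j) else pgen (M_u 2 j))
    = (if i = 1 then (if j = 1 then 1 else 0) else if i = 2 then (if j = 2 then 1 else 0)
        else if i = 3 then pgen (M_u 1 j) else pgen (M_u 2 j))" for i :: 4 and j :: 2
    by (simp add: spart_one)
  show "spart 1 (pgen (M_nu k l)) = pgen (M_nu k l)" for k l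
    using pgen_parity[of "M_nu k l"] by (simp add: gpar_M_gen_def)
qed (simp_all add: spart_one)

lemma S_restrict_hom: "superalgebra_hom S_restrict"
  unfolding S_restrict_def by (rule pres_lift_hom[OF S_restrict_respects])

lemma S_restrict_gen:
  "S_restrict (pgen (S_a (upper_row i) j)) = (if i = j then 1 else 0)"
  "S_restrict (pgen (S_a (lower_row i) j)) = pgen (M_u i j)"
  "S_restrict (pgen (S_alpha k l)) = pgen (M_nu k l)"
  "S_restrict (pgen S_T) = 1"
  unfolding S_restrict_def using exhaust_2[of i] exhaust_2[of j]
  by (auto simp only: pres_lift_gen[OF S_restrict_respects] S_gen.case upper_row_def lower_row_def
      distinct_4 one_neq_two if_True if_False simp_thms)

text \<open>Setting the upper block to the identity matrix amounts to evaluating functions on GL_2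
  at the identity element.\<close>

lemma S_restrict_cleaving: "S_restrict (S_cleaving x) = GL2_counit x *\<^sub>C 1"
proof (rule hom_pres_alg_eqI[of "\<lambda>x. S_restrict (S_cleaving x)" "\<lambda>x. GL2_counit x *\<^sub>C 1"])
  show "S_restrict (S_cleaving (pgen g)) = GL2_counit (pgen g) *\<^sub>C 1" for g
    by (cases g) (simp_all add: S_cleaving_gen S_restrict_gen GL2_counit_gen)
qed (intro superalgebra_hom_comp[OF S_restrict_hom] S_cleaving_hom unit_hom GL2_counit_hom)+

lemma GL2_counit_antipode: "GL2_counit (GL2_antipode (pgen (GL_g i j))) = (if i = j then 1 else 0)"
  by (simp add: GL2_antipode_gen superalgebra_homD[OF GL2_counit_hom] GL2_counit_gen)

text \<open>On the section the inverse of the upper block is the identity too, so the affine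
  coordinates restrict to the lower entries. This is what makes \<open>M_embed\<close>
  injective.\<close>

lemma S_restrict_embed: "S_restrict (M_embed x) = x"
proof (rule hom_pres_alg_eqI[of "\<lambda>x. S_restrict (M_embed x)" "\<lambda>x. x"])
  show "S_restrict (M_embed (pgen g)) = pgen g" for g
    using exhaust_2
    by (cases g) (auto simp: M_embed_gen sum_2 superalgebra_homD[OF S_restrict_hom] S_restrict_gen
        S_restrict_cleaving GL2_counit_antipode)
qed (intro superalgebra_hom_comp[OF S_restrict_hom] M_embed_hom superalgebra_hom_id)+

lemma M_embed_coinvariant: "M_embed x \<in> coinvariants S_coaction"
proof -
  have "S_coaction (M_embed x) = M_embed x \<otimes> 1"
  proof (rule hom_pres_alg_eqI[of "\<lambda>x. S_coaction (M_embed x)" "\<lambda>x. M_embed x \<otimes> 1"])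
    show "S_coaction (M_embed (pgen g)) = M_embed (pgen g) \<otimes> 1" for g
    proof (cases g)
      case (M_u i j)
      show ?thesis unfolding M_u M_embed_gen by (rule coinvariant_row(2)[where b = "\<lambda>l. pgen (S_a (lower_row i) l)", OF S_coaction_gen(1)])
    next
      case (M_nu k l)
      show ?thesis unfolding M_nu M_embed_gen by (rule coinvariant_row(2)[where b = "\<lambda>l. pgen (S_alpha k l)", OF S_coaction_gen(2)])
    qed
  qed (intro superalgebra_hom_comp[OF S_coaction_hom] superalgebra_hom_comp[OF inl_hom] M_embed_hom)+
  then show ?thesis by (simp add: coinvariants_def)
qed

section \<open>The decomposition of C[S] and the identification of the coinvariants\<close>

lemma row_cases:
  fixes i :: 4
  obtains k where "i = upper_row k" | k where "i = lower_row k"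
  using exhaust_4[of i] that(1)[of 1] that(1)[of 2] that(2)[of 1] that(2)[of 2]
  by (auto simp only: upper_row_def lower_row_def one_neq_two if_True if_False simp_thms)

text \<open>On generators this is the factorization of the generic matrix into the matrix with
  identity upper block and rows u, \<nu> below, times its own upper block. The lower rows are
  \<open>coinvariant_row(1)\<close>.\<close>

lemma S_normal_basis:
  "tlift (\<lambda>b x. M_embed (S_restrict b) * S_cleaving x) (S_coaction a) = a"
proof -
  note hom = superalgebra_hom_comp[OF M_embed_hom S_restrict_hom] S_cleaving_hom
  note simps = S_coaction_gen tlift_gens[OF hom] S_restrict_gen M_embed_gen
  show ?thesis
  proof (rule hom_pres_alg_eqI[of _ "\<lambda>x. x"])
    fix g
    show "tlift (\<lambda>b x. M_embed (S_restrict b) * S_cleaving x) (S_coaction (pgen g)) = pgen g"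
    proof (cases g)
      case (S_a i j)
      show ?thesis
      proof (cases i rule: row_cases)
        case (1 k)
        have "(\<Sum>m\<in>UNIV. M_embed (if k = m then 1 else 0) * S_cleaving (pgen (GL_g m j)))
            = pgen (S_a (upper_row k) j)"
          using exhaust_2[of k]
          by (auto simp: sum_2 S_cleaving_gen superalgebra_homD[OF M_embed_hom])
        then show ?thesis by (simp add: S_a 1 simps)
      next
        case (2 k)
        show ?thesis using coinvariant_row(1)[where b = "\<lambda>l. pgen (S_a (lower_row k) l)", OF S_coaction_gen(1), of j]
          by (simp add: S_a 2 simps)
      qed
    next
      case (S_alpha k l)
      show ?thesis using coinvariant_row(1)[where b = "\<lambda>l. pgen (S_alpha k l)", OF S_coaction_gen(2), of l]
        by (simp add: S_alpha simps)
    next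
      case S_T
      then show ?thesis by (simp add: simps S_cleaving_gen superalgebra_homD[OF M_embed_hom])
    qed
  qed (intro superalgebra_hom_comp[OF tlift_hom] hom S_coaction_hom superalgebra_hom_id)+
qed

theorem proposition7p8:
  shows "trivial_hopf_galois GL2_comult GL2_counit GL2_antipode S_coaction \<and>
    (\<exists>\<phi> :: C_M \<Rightarrow> C_S.
       superalgebra_hom \<phi> \<and> bij_betw \<phi> UNIV (coinvariants S_coaction))"
proof (intro conjI exI)
  have "hopf_galois GL2_comult GL2_counit GL2_antipode S_coaction"
    by (rule cleft_hopf_galois[where q = "\<lambda>a. M_embed (S_restrict a)",
          OF GL2_hopf S_comodule S_cleaving_map])
      (intro S_normal_basis M_embed_coinvariant
        superalgebra_homD(1)[OF superalgebra_hom_comp[OF M_embed_hom S_restrict_hom]])+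
  then show "trivial_hopf_galois GL2_comult GL2_counit GL2_antipode S_coaction"
    using S_cleaving_map by (auto simp: trivial_hopf_galois_def)
  show "superalgebra_hom M_embed" by (rule M_embed_hom)
  have "a \<in> range M_embed" if "a \<in> coinvariants S_coaction" for a
  proof -
    \<comment> \<open>For coinvariant a the decomposition has a single term whose second factor is
      \<open>S_cleaving 1\<close>, that is 1.\<close>
    have "tlift (\<lambda>b x. M_embed (S_restrict b) * S_cleaving x) (a \<otimes> 1) = a"
      using that S_normal_basis[of a] by (simp add: coinvariants_def)
    then have "a = M_embed (S_restrict a)"
      using tlift_gens(1)[OF superalgebra_hom_comp[OF M_embed_hom S_restrict_hom] S_cleaving_hom, of a 1]
      by (simp add: superalgebra_homD[OF S_cleaving_hom])
    then show ?thesis by blast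
  qed
  moreover have "inj M_embed" by (metis injI S_restrict_embed)
  ultimately show "bij_betw M_embed UNIV (coinvariants S_coaction)"
    using M_embed_coinvariant by (auto simp: bij_betw_def)
qed

end
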